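(* (Associated continuous big $q$-Hermite case.) Let $0<|q|<1$, let $A,a$ be nonzero complex numbers, and let $a_n=q^n$, $b_n^2=\frac{aq}{A}(1-Aq^{n-1})$, with $b_n^2\neq0$ for $n\ge1$. Let $\gamma_1=2\sqrt{aq/A}$ and $\Lambda'_\pm=\frac12\big(z\pm\sqrt{z^2-\gamma_1^2}\big)$. For $x=z/\gamma_1\in\mathbb{C}\setminus[-1,1]$, with the square root branch chosen so that $|\Lambda'_-/\Lambda'_+|<1$, $$\cfrac{1}{z-a_0-\cfrac{b_1^2}{z-a_1-\cfrac{b_2^2}{z-a_2-\cdots}}}=\frac{A\Lambda'_-}{aq}\;\frac{{}_2\phi_1\left(\begin{matrix}A,\,A\Lambda'_-\\0\end{matrix};\frac{\Lambda'_-}{a}\right)}{{}_2\phi_1\left(\begin{matrix}A/q,\,A\Lambda'_-\\0\end{matrix};\frac{\Lambda'_-}{a}\right)}=\int_{-1}^1\frac{\omega(t)\,dt}{z-\gamma_1t}+\text{possible pole terms},$$ where, for $x\in(-1,1)$, $x=\frac12(u+u^{-1})$, $\Lambda'_\pm=\frac{\gamma_1}{2}\big(x\pm i\sqrt{1-x^2}\big)$, $$\omega(x)=\frac{1}{2\pi\sqrt{1-x^2}}\;\frac{(A)_\infty(u^{-2},u^2)_\infty}{\left(\frac{\gamma_1u}{2a},\frac{\gamma_1}{2au}\right)_\infty}\left[{}_2\phi_1\left(\begin{matrix}A/q,\,A\Lambda'_-\\0\end{matrix};\frac{\Lambda'_-}{a}\right){}_2\phi_1\left(\begin{matrix}A/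q,\,A\Lambda'_+\\0\end{matrix};\frac{\Lambda'_+}{a}\right)\right]^{-1}.$$
   Context: Notation: $(a)_k=\prod_{j=0}^{k-1}(1-aq^j)$ ($k$ a nonnegative integer or $\infty$), $(a_1,\dots,a_m)_k=\prod_i(a_i)_k$, and ${}_2\phi_1\left(\begin{matrix}b,c\\ 0\end{matrix};w\right)=\sum_{k\ge0}\frac{(b)_k(c)_k}{(q)_k}w^k$ for $|w|<1$, and by analytic continuation for $|w|\ge1$. "Possible pole terms" are contributions from possible pole singularities of the function on the left.
   Formalization: The integral representation is stated only when ω is absolutely integrable on [-1,1]; otherwise ω has a nonintegrable singularity (e.g. A=q, a=i, 0<q<1) and the integral is undefined. The continued fraction equality is unconditional. *)

theory Defs
  imports "HOL-Complex_Analysis.Complex_Analysis"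
begin

text \<open>q-shifted factorials.\<close>

definition qpoch :: "complex \<Rightarrow> complex \<Rightarrow> nat \<Rightarrow> complex" where
  "qpoch q a k = (\<Prod>j<k. 1 - a * q ^ j)"

definition qpoch_inf :: "complex \<Rightarrow> complex \<Rightarrow> complex" where
  "qpoch_inf q a = (\<Prod>j. 1 - a * q ^ j)"

definition phi21_series :: "complex \<Rightarrow> complex \<Rightarrow> complex \<Rightarrow> complex \<Rightarrow> complex" where
  "phi21_series q b c w = (\<Sum>k. qpoch q b k * qpoch q c k / qpoch q q k * w ^ k)"

text \<open>The function 2phi1(b, c; 0; w), continued from the unit disc to the whole plane. The only
  singularities of the continuation are possible poles at the points \<open>w = 1 / q ^ k\<close>; by convention
  a nicely meromorphic function has the value 0 at its poles and is continuous elsewhere, which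
  makes the continuation unique.\<close>

definition phi21 :: "complex \<Rightarrow> complex \<Rightarrow> complex \<Rightarrow> complex \<Rightarrow> complex" where
  "phi21 q b c = (THE f. f nicely_meromorphic_on UNIV \<and>
                         (\<forall>w. norm w < 1 \<longrightarrow> f w = phi21_series q b c w))"

text \<open>Continued fractions \<open>c 0 / (d 0 + c 1 / (d 1 + c 2 / (d 2 + \<dots>)))\<close>. The \<open>n\<close>-th convergent
  \<open>cf_num c d n / cf_den c d n\<close> keeps the partial quotients of index less than \<open>n\<close>. Passing through
  the three-term recurrences avoids the convention \<open>x / 0 = 0\<close> inside a finite nested fraction.\<close>

fun cf_num :: "(nat \<Rightarrow> complex) \<Rightarrow> (nat \<Rightarrow> complex) \<Rightarrow> nat \<Rightarrow> complex" where
  "cf_num c d 0 = 0"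
| "cf_num c d (Suc 0) = c 0"
| "cf_num c d (Suc (Suc n)) = d (Suc n) * cf_num c d (Suc n) + c (Suc n) * cf_num c d n"

fun cf_den :: "(nat \<Rightarrow> complex) \<Rightarrow> (nat \<Rightarrow> complex) \<Rightarrow> nat \<Rightarrow> complex" where
  "cf_den c d 0 = 1"
| "cf_den c d (Suc 0) = d 0"
| "cf_den c d (Suc (Suc n)) = d (Suc n) * cf_den c d (Suc n) + c (Suc n) * cf_den c d n"

definition cf_converges_to :: "(nat \<Rightarrow> complex) \<Rightarrow> (nat \<Rightarrow> complex) \<Rightarrow> complex \<Rightarrow> bool" where
  "cf_converges_to c d L \<longleftrightarrow>
     (\<forall>\<^sub>F n in sequentially. cf_den c d n \<noteq> 0) \<and>
     (\<lambda>n. cf_num c d n / cf_den c d n) \<longlonglongrightarrow> L"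

text \<open>Convergence to the point at infinity of the Riemann sphere.\<close>

definition cf_converges_to_infinity :: "(nat \<Rightarrow> complex) \<Rightarrow> (nat \<Rightarrow> complex) \<Rightarrow> bool" where
  "cf_converges_to_infinity c d \<longleftrightarrow>
     (\<forall>\<^sub>F n in sequentially. cf_num c d n \<noteq> 0) \<and>
     (\<lambda>n. cf_den c d n / cf_num c d n) \<longlonglongrightarrow> 0"

text \<open>Recurrence coefficients: \<open>rec_a q n\<close> is \<open>a_n\<close> and \<open>rec_b2 q A a n\<close> is \<open>b_n^2\<close> (used only for
  \<open>n \<ge> 1\<close>).\<close>

definition rec_a :: "complex \<Rightarrow> nat \<Rightarrow> complex" where
  "rec_a q n = q ^ n"

definition rec_b2 :: "complex \<Rightarrow> complex \<Rightarrow> complex \<Rightarrow> nat \<Rightarrow> complex" where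
  "rec_b2 q A a n = a * q / A * (1 - A * q ^ (n - 1))"

definition bqH_cf_c :: "complex \<Rightarrow> complex \<Rightarrow> complex \<Rightarrow> nat \<Rightarrow> complex" where
  "bqH_cf_c q A a n = (if n = 0 then 1 else - rec_b2 q A a n)"

definition bqH_cf_d :: "complex \<Rightarrow> complex \<Rightarrow> nat \<Rightarrow> complex" where
  "bqH_cf_d q z n = z - rec_a q n"

text \<open>Here \<open>g\<close> stands for \<open>\<gamma>_1\<close>. The branch of the square root of \<open>z^2 - g^2\<close> is the one with
  \<open>|\<Lambda>'_-| < |\<Lambda>'_+|\<close>; it exists and is unique exactly when \<open>z / g\<close> is off \<open>[-1, 1]\<close>.\<close>

definition branch_sqrt :: "complex \<Rightarrow> complex \<Rightarrow> complex" where
  "branch_sqrt g z =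
     (let s = csqrt (z\<^sup>2 - g\<^sup>2)
      in if norm ((z - s) / 2) < norm ((z + s) / 2) then s else - s)"

definition Lambda_minus :: "complex \<Rightarrow> complex \<Rightarrow> complex" where
  "Lambda_minus g z = (z - branch_sqrt g z) / 2"

definition cut_domain :: "complex \<Rightarrow> complex set" where
  "cut_domain g = {z. z / g \<notin> complex_of_real ` {-1..1}}"

text \<open>The quotient of basic hypergeometric functions, by pointwise evaluation. At isolated points
  where a factor has a pole or the denominator vanishes, the value is an artefact of \<open>x / 0 = 0\<close>;
  \<open>remove_sings\<close> of this function is the meromorphic function meant.\<close>

definition bqH_ratio :: "complex \<Rightarrow> complex \<Rightarrow> complex \<Rightarrow> complex \<Rightarrow> complex \<Rightarrow> complex" where
  "bqH_ratio q A a g z =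
     (let L = Lambda_minus g z
      in A * L / (a * q) * (phi21 q A (A * L) (L / a) / phi21 q (A / q) (A * L) (L / a)))"

definition bqH_poles :: "complex \<Rightarrow> complex \<Rightarrow> complex \<Rightarrow> complex \<Rightarrow> complex set" where
  "bqH_poles q A a g = {p \<in> cut_domain g. is_pole (bqH_ratio q A a g) p}"

text \<open>The residue at \<open>p\<close> of \<open>F \<zeta> / (z - \<zeta>)\<close> is the value at \<open>z\<close> of the principal part of \<open>F\<close> at
  \<open>p\<close>; for a simple pole it is \<open>residue F p / (z - p)\<close>.\<close>

definition bqH_pole_terms :: "complex \<Rightarrow> complex \<Rightarrow> complex \<Rightarrow> complex \<Rightarrow> complex \<Rightarrow> complex" where
  "bqH_pole_terms q A a g z =
     (\<Sum>p\<in>bqH_poles q A a g. residue (\<lambda>\<zeta>. bqH_ratio q A a g \<zeta> / (z - \<zeta>)) p)"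

text \<open>The weight. Of the two solutions \<open>u\<close> of \<open>x = (u + 1 / u) / 2\<close> we take
  \<open>x + \<i> sqrt (1 - x^2)\<close>; the expression is symmetric under \<open>u \<mapsto> 1 / u\<close>.\<close>

definition bqH_weight :: "complex \<Rightarrow> complex \<Rightarrow> complex \<Rightarrow> complex \<Rightarrow> real \<Rightarrow> complex" where
  "bqH_weight q A a g x =
     (let u = Complex x (sqrt (1 - x\<^sup>2));
          Lp = g / 2 * (of_real x + \<i> * of_real (sqrt (1 - x\<^sup>2)));
          Lm = g / 2 * (of_real x - \<i> * of_real (sqrt (1 - x\<^sup>2)))
      in 1 / (2 * of_real pi * of_real (sqrt (1 - x\<^sup>2)))
         * (qpoch_inf q A * (qpoch_inf q (1 / u\<^sup>2) * qpoch_inf q (u\<^sup>2))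
            / (qpoch_inf q (g * u / (2 * a)) * qpoch_inf q (g / (2 * a * u))))
         * inverse (phi21 q (A / q) (A * Lm) (Lm / a) * phi21 q (A / q) (A * Lp) (Lp / a)))"

end

theory Submission
  imports Defs
begin

text \<open>
  Write \<open>z = L + L'\<close> with \<open>L * L' = a q / A\<close> and \<open>|L| < |L'|\<close>. Jackson's transformation turns
  \<open>(L / a)\<^sub>\<infinity> 2phi1(A q\<^sup>m\<^sup>-\<^sup>1, A L; 0; L / a)\<close> into a series \<open>S\<^sub>m(L)\<close> that is entire in \<open>L\<close>, and
  \<open>S\<^sub>m(L) / L'\<^sup>m\<close> is the minimal solution of the recurrence adjoint to that of the convergents.
  Pairing it with the numerators and denominators shows that these, divided by \<open>L'\<^sup>n\<close>, converge to
  common multiples of \<open>S\<^sub>1(L) / L'\<close> and \<open>S\<^sub>0(L)\<close>; hence the continued fraction equals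
  \<open>S\<^sub>1(L) / (L' S\<^sub>0(L))\<close>, with a pole exactly where \<open>S\<^sub>0\<close> vanishes.

  With \<open>L = g v / 2\<close> this is a meromorphic function of \<open>v\<close> on the whole plane, and the cut \<open>[-1, 1]\<close>
  corresponds to the unit circle. The Casoratian of the solutions for \<open>L\<close> and \<open>L'\<close> evaluates the
  jump across the cut in closed form, which is the weight, and the residue theorem on the unit disc
  gives the integral representation. Absolute integrability of the weight excludes zeros of \<open>S\<^sub>0\<close>
  on the circle, except for simple ones at \<open>v = \<plusminus>1\<close>, where the factor \<open>dz / dv\<close> vanishes.
\<close>

subsection \<open>q-shifted factorials\<close>

text \<open>The quotient in the theorem is only a pointwise expression, with accidental values where
  \<open>phi21\<close> has a pole. The common factor (L/a)_inf removes these poles from numerator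
  and denominator at once and cancels in the quotient; what remains is a quotient of entire
  functions, which agrees with the pointwise expression off isolated points. Being entire, the same
  functions can be evaluated at both preimages u and 1/u of a point of the cut, so that the jump is
  an algebraic identity on the circle and needs no limit from either side. In these terms the weight
  is sqrt(1 - x^2) over the product of the denominators at u and 1/u, up to a factor without zeros
  on the circle. A zero at an interior point x1 makes the weight grow at least like 1/|x - x1|, and
  a multiple zero at v = 1 or v = -1 at least like the power -3/2 of the distance to the endpoint. A
  simple zero there gives only the power -1/2, which is integrable; it cannot be excluded and has to
  be cancelled in the kernel.\<close>

lemma qpoch_0 [simp]: "qpoch q a 0 = 1"
  by (simp add: qpoch_def)

lemma qpoch_Suc: "qpoch q a (Suc k) = qpoch q a k * (1 - a * q ^ k)"
  by (simp add: qpoch_def)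

lemma qpoch_add: "qpoch q a (j + m) = qpoch q a j * qpoch q (a * q ^ j) m"
  by (induction m) (auto simp: qpoch_Suc power_add mult_ac)

lemma qpoch_eq_0_iff: "qpoch q a k = 0 \<longleftrightarrow> (\<exists>j<k. a * q ^ j = 1)"
  by (auto simp: qpoch_def)

context
  fixes q :: complex
  assumes q: "norm q < 1"
begin

lemma mult_power_neq_1:
  assumes "norm a < 1"
  shows "a * q ^ j \<noteq> 1"
proof -
  have "norm (a * q ^ j) \<le> norm a * 1"
    unfolding norm_mult norm_power using q by (intro mult_left_mono power_le_one) auto
  with assms show ?thesis by auto
qed

lemma qpoch_q_nonzero [simp]: "qpoch q q k \<noteq> 0"
  using mult_power_neq_1[OF q] by (auto simp: qpoch_eq_0_iff)

lemma one_minus_power_nonzero: "1 - q ^ Suc k \<noteq> 0"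
  using mult_power_neq_1[OF q, of k] by auto

text \<open>The inequality 1 + x <= exp x turns the product into the exponential of a geometric sum.
  The bound does not depend on k and therefore passes to \<open>qpoch_inf\<close>.\<close>

lemma norm_qpoch_le:
  assumes "norm a \<le> M"
  shows "norm (qpoch q a k) \<le> exp (M / (1 - norm q))"
proof -
  have M: "0 \<le> M" using assms norm_ge_zero order_trans by blast
  have "norm (qpoch q a k) = (\<Prod>j<k. norm (1 - a * q ^ j))"
    by (simp add: qpoch_def prod_norm)
  also have "\<dots> \<le> (\<Prod>j<k. exp (M * norm q ^ j))"
  proof (intro prod_mono conjI)
    fix j
    have "norm (1 - a * q ^ j) \<le> 1 + norm a * norm q ^ j"
      using norm_triangle_ineq4[of 1 "a * q ^ j"] by (simp add: norm_mult norm_power)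
    also have "\<dots> \<le> 1 + M * norm q ^ j"
      using assms by (intro add_left_mono mult_right_mono) auto
    also have "\<dots> \<le> exp (M * norm q ^ j)" by (rule exp_ge_add_one_self)
    finally show "norm (1 - a * q ^ j) \<le> exp (M * norm q ^ j)" .
  qed auto
  also have "\<dots> = exp (M * (\<Sum>j<k. norm q ^ j))"
    by (simp add: exp_sum sum_distrib_left)
  also have "(\<Sum>j<k. norm q ^ j) \<le> (\<Sum>j. norm q ^ j)"
    using q by (intro sum_le_suminf) auto
  hence "exp (M * (\<Sum>j<k. norm q ^ j)) \<le> exp (M * (1 / (1 - norm q)))"
    using q M by (simp only: exp_le_cancel_iff) (intro mult_left_mono, auto simp: suminf_geometric)
  finally show ?thesis by simp
qed

lemma convergent_prod_qpoch: "convergent_prod (\<lambda>j. 1 - a * q ^ j)"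
proof (rule abs_convergent_prod_imp_convergent_prod, rule summable_imp_abs_convergent_prod)
  show "summable (\<lambda>i. norm (1 - a * q ^ i - 1))"
    using q by (simp add: norm_mult norm_power summable_mult summable_geometric)
qed

lemma qpoch_tendsto: "qpoch q a \<longlonglongrightarrow> qpoch_inf q a"
proof -
  have "(\<lambda>n. \<Prod>j\<le>n. 1 - a * q ^ j) \<longlonglongrightarrow> qpoch_inf q a"
    unfolding qpoch_inf_def by (rule convergent_prod_LIMSEQ[OF convergent_prod_qpoch])
  hence "(\<lambda>n. qpoch q a (Suc n)) \<longlonglongrightarrow> qpoch_inf q a"
    by (simp add: qpoch_def lessThan_Suc_atMost)
  thus ?thesis by (simp add: filterlim_sequentially_Suc)
qed

lemma norm_qpoch_inf_le:
  assumes "norm a \<le> M"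
  shows "norm (qpoch_inf q a) \<le> exp (M / (1 - norm q))"
  by (rule LIMSEQ_le_const2[OF tendsto_norm[OF qpoch_tendsto]])
     (use norm_qpoch_le[OF assms] in auto)

lemma qpoch_inf_shift: "qpoch_inf q a = qpoch q a k * qpoch_inf q (a * q ^ k)"
proof -
  have "(\<lambda>n. qpoch q a k * qpoch q (a * q ^ k) n) \<longlonglongrightarrow> qpoch q a k * qpoch_inf q (a * q ^ k)"
    by (intro tendsto_intros qpoch_tendsto)
  hence "(\<lambda>n. qpoch q a (n + k)) \<longlonglongrightarrow> qpoch q a k * qpoch_inf q (a * q ^ k)"
    by (simp add: qpoch_add[symmetric] add.commute)
  moreover have "(\<lambda>n. qpoch q a (n + k)) \<longlonglongrightarrow> qpoch_inf q a"
    by (intro LIMSEQ_ignore_initial_segment qpoch_tendsto)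
  ultimately show ?thesis using LIMSEQ_unique by blast
qed

lemma qpoch_inf_Suc: "qpoch_inf q a = (1 - a) * qpoch_inf q (a * q)"
  using qpoch_inf_shift[of a 1] by (simp add: qpoch_Suc)

lemma qpoch_inf_eq_0_iff: "qpoch_inf q a = 0 \<longleftrightarrow> (\<exists>j. a * q ^ j = 1)"
proof
  assume "\<exists>j. a * q ^ j = 1"
  then obtain j where "a * q ^ j = 1" by blast
  hence "qpoch q a (Suc j) = 0" by (auto simp: qpoch_eq_0_iff)
  thus "qpoch_inf q a = 0" using qpoch_inf_shift[of a "Suc j"] by simp
next
  assume *: "qpoch_inf q a = 0"
  show "\<exists>j. a * q ^ j = 1"
  proof (rule ccontr)
    assume "\<nexists>j. a * q ^ j = 1"
    hence "qpoch_inf q a \<noteq> 0"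
      unfolding qpoch_inf_def
      by (intro prodinf_nonzero convergent_prod_qpoch) (metis eq_iff_diff_eq_0)
    with * show False by simp
  qed
qed

lemma qpoch_inf_nonzero: "norm a < 1 \<Longrightarrow> qpoch_inf q a \<noteq> 0"
  using mult_power_neq_1 by (auto simp: qpoch_inf_eq_0_iff)

lemma qpoch_inf_0 [simp]: "qpoch_inf q 0 = 1"
  by (simp add: qpoch_inf_def)

lemma qpoch_holomorphic [holomorphic_intros]:
  assumes "f holomorphic_on S"
  shows "(\<lambda>x. qpoch q (f x) k) holomorphic_on S"
  unfolding qpoch_def using assms by (intro holomorphic_intros)

lemma qpoch_inf_entire: "qpoch_inf q holomorphic_on UNIV"
proof (rule holomorphic_uniform_sequence[where f = "\<lambda>n a. qpoch q a n"])
  fix x :: complex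
  have "uniformly_convergent_on (cball x 1) (\<lambda>N a. \<Sum>n<N. norm ((1 - a * q ^ n) - 1))"
  proof (rule Weierstrass_m_test')
    show "summable (\<lambda>n. (norm x + 1) * norm q ^ n)"
      using q by (intro summable_mult summable_geometric) auto
    fix n a assume "a \<in> cball x 1"
    hence "norm a \<le> norm x + 1"
      using norm_triangle_ineq4[of x "x - a"] by (simp add: dist_norm)
    thus "norm (norm ((1 - a * q ^ n) - 1)) \<le> (norm x + 1) * norm q ^ n"
      by (auto simp: norm_mult norm_power intro!: mult_right_mono)
  qed
  hence "uniformly_convergent_on (cball x 1) (\<lambda>N a. \<Prod>n<N. 1 - a * q ^ n)"
    by (intro uniformly_convergent_on_prod') (auto intro!: continuous_intros)
  hence "uniform_limit (cball x 1) (\<lambda>N a. qpoch q a N) (\<lambda>a. lim (\<lambda>N. qpoch q a N)) sequentially"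
    by (simp add: uniformly_convergent_uniform_limit_iff qpoch_def)
  moreover have "lim (\<lambda>N. qpoch q a N) = qpoch_inf q a" for a
    using qpoch_tendsto by (simp add: limI)
  ultimately have "uniform_limit (cball x 1) (\<lambda>N a. qpoch q a N) (qpoch_inf q) sequentially"
    by simp
  thus "\<exists>d>0. cball x d \<subseteq> UNIV \<and>
          uniform_limit (cball x d) (\<lambda>n a. qpoch q a n) (qpoch_inf q) sequentially"
    by (intro exI[of _ 1]) auto
qed (auto intro!: holomorphic_intros)

lemma qpoch_inf_holomorphic [holomorphic_intros]:
  assumes "f holomorphic_on S"
  shows "(\<lambda>x. qpoch_inf q (f x)) holomorphic_on S"
  using holomorphic_on_compose[OF assms holomorphic_on_subset[OF qpoch_inf_entire]]
  by (simp add: o_def)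

section \<open>Majorants and the q-binomial theorem\<close>

lemma inverse_qpoch_q_bounded:
  obtains K where "K > 0" "\<And>k. norm (1 / qpoch q q k) \<le> K"
proof -
  have "(\<lambda>k. 1 / qpoch q q k) \<longlonglongrightarrow> 1 / qpoch_inf q q"
    by (intro tendsto_intros qpoch_tendsto qpoch_inf_nonzero q)
  hence "Bseq (\<lambda>k. 1 / qpoch q q k)"
    by (rule convergent_imp_Bseq[OF convergentI])
  thus ?thesis using that by (auto elim!: BseqE)
qed

text \<open>The terms are X^k |q|^(k(k-1)/2), whose ratio X |q|^k tends to 0. As X is arbitrary,
  power series dominated in this way have infinite radius of convergence.\<close>

lemma summable_prod_power:
  fixes X :: real
  assumes "0 \<le> X"
  shows "summable (\<lambda>k. \<Prod>j<k. X * norm q ^ j)"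
proof -
  have "(\<lambda>n. X * norm q ^ n) \<longlonglongrightarrow> X * 0"
    using q by (intro tendsto_intros LIMSEQ_power_zero) auto
  hence "eventually (\<lambda>n. X * norm q ^ n < 1/2) sequentially"
    by (rule order_tendstoD) auto
  then obtain N where N: "\<And>n. n \<ge> N \<Longrightarrow> X * norm q ^ n < 1/2"
    by (auto simp: eventually_sequentially)
  show ?thesis
  proof (rule summable_ratio_test[of "1/2" N])
    fix n assume "N \<le> n"
    from N[OF this] have "X * norm q ^ n \<le> 1/2" by simp
    hence "(X * norm q ^ n) * (\<Prod>j<n. X * norm q ^ j) \<le> 1/2 * (\<Prod>j<n. X * norm q ^ j)"
      using assms by (intro mult_right_mono prod_nonneg) auto
    thus "norm (\<Prod>j<Suc n. X * norm q ^ j) \<le> 1/2 * norm (\<Prod>j<n. X * norm q ^ j)"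
      using assms by (simp add: prod_nonneg abs_mult mult.commute)
  qed auto
qed

text \<open>The finite q-binomial theorem; the product over \<open>i\<close> is (-b)^j q^(j(j-1)/2).
  The induction rests on a q-Pascal rule for the summands, stated as \<open>*\<close>.\<close>

lemma qpoch_div_qpoch_q_expand:
  "qpoch q b k / qpoch q q k =
     (\<Sum>j\<le>k. (\<Prod>i<j. - b * q ^ i) / (qpoch q q j * qpoch q q (k - j)))"
proof (induction k)
  case (Suc k)
  define T where "T k j = (\<Prod>i<j. - b * q ^ i) / (qpoch q q j * qpoch q q (k - j))" for k j
  have *: "(1 - q ^ Suc k) * T (Suc k) j =
           (if j \<le> k then T k j else 0) - b * q ^ k * (if j = 0 then 0 else T k (j - 1))"
    if j: "j \<le> Suc k" for j
  proof -
    \<comment> \<open>Each part of this splitting cancels the last factor of one of the two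
      q-factorials in the denominator of \<open>T (Suc k) j\<close>; this gives the two terms of the
      Pascal rule.\<close>
    have split: "1 - q ^ Suc k = (1 - q ^ (Suc k - j)) + q ^ (Suc k - j) * (1 - q ^ j)"
      using j by (simp add: algebra_simps flip: power_add)
    have 1: "(1 - q ^ (Suc k - j)) * T (Suc k) j = (if j \<le> k then T k j else 0)"
    proof (cases "j \<le> k")
      case True
      hence "Suc k - j = Suc (k - j)" by simp
      thus ?thesis using True one_minus_power_nonzero[of "k - j"]
        by (simp add: T_def qpoch_Suc)
    qed (use j in \<open>simp add: not_le le_Suc_eq\<close>)
    have 2: "q ^ (Suc k - j) * (1 - q ^ j) * T (Suc k) j =
             - (b * q ^ k * (if j = 0 then 0 else T k (j - 1)))"
    proof (cases j)
      case (Suc i)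
      have "q ^ k = q ^ (k - i) * q ^ i" using j Suc by (simp flip: power_add)
      thus ?thesis using Suc one_minus_power_nonzero[of i]
        by (simp add: T_def qpoch_Suc divide_simps)
    qed auto
    show ?thesis unfolding split distrib_right 1 2 by simp
  qed
  have "(1 - q ^ Suc k) * (\<Sum>j\<le>Suc k. T (Suc k) j) =
        (\<Sum>j\<le>Suc k. (if j \<le> k then T k j else 0) - b * q ^ k * (if j = 0 then 0 else T k (j - 1)))"
    unfolding sum_distrib_left by (intro sum.cong) (use * in auto)
  also have "\<dots> = (\<Sum>j\<le>Suc k. if j \<le> k then T k j else 0)
                  - b * q ^ k * (\<Sum>j\<le>Suc k. if j = 0 then 0 else T k (j - 1))"
    by (simp only: sum_subtractf sum_distrib_left)
  also have "(\<Sum>j\<le>Suc k. if j \<le> k then T k j else 0) = (\<Sum>j\<le>k. T k j)"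
    by simp
  also have "(\<Sum>j\<le>Suc k. if j = 0 then 0 else T k (j - 1)) = (\<Sum>j\<le>k. T k j)"
    by (subst sum.atMost_Suc_shift) simp
  finally have "(1 - q ^ Suc k) * (\<Sum>j\<le>Suc k. T (Suc k) j) = (1 - b * q ^ k) * (\<Sum>j\<le>k. T k j)"
    by (simp add: algebra_simps)
  also have "(\<Sum>j\<le>k. T k j) = qpoch q b k / qpoch q q k"
    using Suc.IH by (simp add: T_def)
  finally have "(\<Sum>j\<le>Suc k. T (Suc k) j) = qpoch q b (Suc k) / qpoch q q (Suc k)"
    using one_minus_power_nonzero[of k] by (simp add: qpoch_Suc divide_simps mult_ac del: sum.atMost_Suc)
  thus ?case by (simp add: T_def del: sum.atMost_Suc)
qed auto

text \<open>The sum H satisfies (1 - v) H(v) = (1 - c v) H(v q). Iteration moves the argument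
  towards 0, where H is continuous with value 1, and the accumulated factors converge to the two
  infinite products.\<close>

lemma q_binomial:
  assumes w: "norm w < 1"
  shows "(\<lambda>k. qpoch q c k / qpoch q q k * w ^ k) sums (qpoch_inf q (c * w) / qpoch_inf q w)"
    and "summable (\<lambda>k. norm (qpoch q c k / qpoch q q k * w ^ k))"
proof -
  define h where "h k = qpoch q c k / qpoch q q k" for k
  obtain K where K: "K > 0" "\<And>k. norm (1 / qpoch q q k) \<le> K"
    using inverse_qpoch_q_bounded by blast
  define M where "M = exp (norm c / (1 - norm q)) * K"
  have hM: "norm (h k) \<le> M" for k
  proof -
    have "norm (h k) = norm (qpoch q c k) * norm (1 / qpoch q q k)"
      by (simp add: h_def norm_divide)
    also have "\<dots> \<le> M" unfolding M_def
      by (intro mult_mono norm_qpoch_le K) auto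
    finally show ?thesis .
  qed
  have abs: "summable (\<lambda>k. norm (h k * v ^ k))" if "norm v < 1" for v
  proof (rule summable_comparison_test')
    show "summable (\<lambda>k. M * norm v ^ k)"
      using that by (intro summable_mult summable_geometric) auto
    show "norm (norm (h k * v ^ k)) \<le> M * norm v ^ k" if "k \<ge> 0" for k
      using hM by (simp add: norm_mult norm_power mult_right_mono)
  qed
  define H where "H v = (\<Sum>k. h k * v ^ k)" for v
  have smm: "summable (\<lambda>k. h k * v ^ k)" if "norm v < 1" for v
    using abs[OF that] by (rule summable_norm_cancel)
  have rec: "(1 - v) * H v = (1 - c * v) * H (v * q)" if v: "norm v < 1" for v
  proof -
    have vq: "norm (v * q) < 1"
      using mult_left_mono[of "norm q" 1 "norm v"] v q by (simp add: norm_mult)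
    have hrec: "h (Suc k) * (1 - q ^ Suc k) = h k * (1 - c * q ^ k)" for k
      using one_minus_power_nonzero[of k] by (simp add: h_def qpoch_Suc divide_simps)
    have "H v - H (v * q) = (\<Sum>k. h k * v ^ k - h k * (v * q) ^ k)"
      unfolding H_def by (intro suminf_diff smm v vq)
    also have "\<dots> = (\<Sum>k. h k * (1 - q ^ k) * v ^ k)"
      by (simp add: algebra_simps power_mult_distrib)
    also have "\<dots> = (\<Sum>k. h (Suc k) * (1 - q ^ Suc k) * v ^ Suc k)"
      by (subst suminf_split_head) (use summable_diff[OF smm[OF v] smm[OF vq]] in \<open>auto simp: algebra_simps power_mult_distrib\<close>)
    also have "\<dots> = (\<Sum>k. v * (h k * v ^ k) - c * v * (h k * (v * q) ^ k))"
      unfolding hrec by (simp add: algebra_simps power_mult_distrib)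
    also have "\<dots> = (\<Sum>k. v * (h k * v ^ k)) - (\<Sum>k. c * v * (h k * (v * q) ^ k))"
      by (intro suminf_diff[symmetric] summable_mult smm v vq)
    also have "\<dots> = v * H v - c * v * H (v * q)"
      unfolding H_def by (simp add: suminf_mult smm v vq)
    finally show ?thesis by (simp add: algebra_simps)
  qed
  have iter: "qpoch q w n * H w = qpoch q (c * w) n * H (w * q ^ n)" for n
  proof (induction n)
    case (Suc n)
    have "norm (w * q ^ n) \<le> norm w * 1" unfolding norm_mult norm_power
      using q by (intro mult_left_mono power_le_one) auto
    hence "norm (w * q ^ n) < 1" using w by simp
    from rec[OF this] Suc.IH show ?case
      by (simp add: qpoch_Suc mult_ac) (metis (no_types, lifting) mult.assoc mult.left_commute)
  qed simp
  have "isCont H 0"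
    unfolding H_def by (rule isCont_powser[where K = "1/2"]) (use smm[of "1/2"] in auto)
  moreover have "(\<lambda>n. w * q ^ n) \<longlonglongrightarrow> w * 0"
    using q by (intro tendsto_intros LIMSEQ_power_zero)
  ultimately have "(\<lambda>n. H (w * q ^ n)) \<longlonglongrightarrow> H 0"
    by (intro isCont_tendsto_compose[where g = H]) auto
  moreover have "H 0 = 1"
    unfolding H_def using powser_zero[of h] by (simp add: h_def)
  ultimately have "(\<lambda>n. qpoch q (c * w) n * H (w * q ^ n)) \<longlonglongrightarrow> qpoch_inf q (c * w) * 1"
    by (intro tendsto_mult qpoch_tendsto) auto
  moreover have "(\<lambda>n. qpoch q w n * H w) \<longlonglongrightarrow> qpoch_inf q w * H w"
    by (intro tendsto_intros qpoch_tendsto)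
  ultimately have "qpoch_inf q w * H w = qpoch_inf q (c * w)"
    using LIMSEQ_unique unfolding iter by fastforce
  hence "H w = qpoch_inf q (c * w) / qpoch_inf q w"
    using qpoch_inf_nonzero[OF w] by (simp add: field_simps)
  thus "(\<lambda>k. qpoch q c k / qpoch q q k * w ^ k) sums (qpoch_inf q (c * w) / qpoch_inf q w)"
    using summable_sums[OF smm[OF w]] unfolding H_def h_def by simp
  show "summable (\<lambda>k. norm (qpoch q c k / qpoch q q k * w ^ k))"
    using abs[OF w] by (simp add: h_def)
qed

end

subsection \<open>Jackson's transformation and the continuation of 2phi1\<close>

text \<open>Since (c w q^k)_inf = (c w)_inf / (c w)_k wherever the latter is nonzero,
  \<open>jackson\<close> is (c w)_inf times the series 1phi1(c; c w; q, b w). Keeping the infinite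
  product in each term avoids the division, so that nothing is singular in \<open>c\<close> or
  \<open>w\<close>. The parameter \<open>b\<close> is separated as the variable of a power series
  because the recurrence shifts b to b q.\<close>

definition jackson_coeff :: "complex \<Rightarrow> complex \<Rightarrow> complex \<Rightarrow> nat \<Rightarrow> complex" where
  "jackson_coeff q c w k =
     qpoch q c k / qpoch q q k * qpoch_inf q (c * w * q ^ k) * (\<Prod>j<k. - w * q ^ j)"

definition jackson :: "complex \<Rightarrow> complex \<Rightarrow> complex \<Rightarrow> complex \<Rightarrow> complex" where
  "jackson q b c w = (\<Sum>k. jackson_coeff q c w k * b ^ k)"

context
  fixes q :: complex
  assumes q: "norm q < 1"
begin

text \<open>The constant \<open>K\<close> depends on \<open>q\<close> alone and the bound is uniform
  for \<open>c\<close> and \<open>w\<close> in discs; it serves both summability and locally uniform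
  convergence.\<close>

lemma jackson_coeff_bound:
  obtains K where "K > 0"
    "\<And>C W c w b k. norm c \<le> C \<Longrightarrow> norm w \<le> W \<Longrightarrow>
       norm (jackson_coeff q c w k * b ^ k) \<le>
         exp (C / (1 - norm q)) * K * exp (C * W / (1 - norm q)) * (\<Prod>j<k. (W * norm b) * norm q ^ j)"
proof -
  obtain K where K: "K > 0" "\<And>k. norm (1 / qpoch q q k) \<le> K"
    using inverse_qpoch_q_bounded[OF q] by blast
  show ?thesis
  proof (rule that[OF K(1)])
    fix C W :: real and c w b :: complex and k
    assume c: "norm c \<le> C" and w: "norm w \<le> W"
    have CW: "0 \<le> C" "0 \<le> W" using c w norm_ge_zero order_trans by blast+
    have cw: "norm (c * w * q ^ k) \<le> C * W"
    proof -
      have "norm (c * w * q ^ k) \<le> norm c * norm w * 1"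
        unfolding norm_mult norm_power using q by (intro mult_left_mono power_le_one) auto
      also have "\<dots> \<le> C * W" using c w CW by (simp add: mult_mono)
      finally show ?thesis .
    qed
    have "norm (jackson_coeff q c w k * b ^ k) =
            norm (qpoch q c k) * norm (1 / qpoch q q k) * norm (qpoch_inf q (c * w * q ^ k)) *
            (\<Prod>j<k. (norm w * norm b) * norm q ^ j)"
      by (simp add: jackson_coeff_def norm_mult norm_divide norm_power prod.distrib
            power_mult_distrib flip: prod_norm)
    also have "\<dots> \<le> exp (C / (1 - norm q)) * K * exp (C * W / (1 - norm q)) *
                    (\<Prod>j<k. (W * norm b) * norm q ^ j)"
      using CW K(1) w
      by (intro mult_mono norm_qpoch_le norm_qpoch_inf_le K(2) c cw prod_mono q mult_nonneg_nonneg prod_nonneg)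
         (auto intro!: mult_right_mono mult_nonneg_nonneg)
    finally show "norm (jackson_coeff q c w k * b ^ k) \<le>
         exp (C / (1 - norm q)) * K * exp (C * W / (1 - norm q)) * (\<Prod>j<k. (W * norm b) * norm q ^ j)" .
  qed
qed

lemma summable_jackson: "summable (\<lambda>k. jackson_coeff q c w k * b ^ k)"
proof -
  obtain K where K: "K > 0"
    "\<And>C W c w b k. norm c \<le> C \<Longrightarrow> norm w \<le> W \<Longrightarrow>
       norm (jackson_coeff q c w k * b ^ k) \<le>
         exp (C / (1 - norm q)) * K * exp (C * W / (1 - norm q)) * (\<Prod>j<k. (W * norm b) * norm q ^ j)"
    using jackson_coeff_bound by blast
  show ?thesis
  proof (rule summable_comparison_test'[OF _ K(2)[OF order_refl order_refl]])
    show "summable (\<lambda>k. exp (norm c / (1 - norm q)) * K * exp (norm c * norm w / (1 - norm q)) *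
            (\<Prod>j<k. (norm w * norm b) * norm q ^ j))"
      by (intro summable_mult summable_prod_power[OF q]) simp
  qed
qed

text \<open>Both \<open>c\<close> and \<open>w\<close> are functions of one parameter, because in
  \<open>sol\<close> they both move with \<open>L\<close>.\<close>

lemma jackson_holomorphic:
  assumes c: "c holomorphic_on S" and w: "w holomorphic_on S" and S: "open S"
  shows "(\<lambda>s. jackson q b (c s) (w s)) holomorphic_on S"
proof (rule holomorphic_uniform_sequence[OF S,
         where f = "\<lambda>n s. \<Sum>k<n. jackson_coeff q (c s) (w s) k * b ^ k"])
  fix n show "(\<lambda>s. \<Sum>k<n. jackson_coeff q (c s) (w s) k * b ^ k) holomorphic_on S"
    unfolding jackson_coeff_def
    by (intro holomorphic_intros c w q) (simp_all add: q)
next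
  fix x assume "x \<in> S"
  then obtain d where d: "d > 0" "cball x d \<subseteq> S"
    using S open_contains_cball by blast
  have "bounded (c ` cball x d)" "bounded (w ` cball x d)"
    by (intro compact_imp_bounded compact_continuous_image compact_cball
          holomorphic_on_imp_continuous_on holomorphic_on_subset[OF c d(2)]
          holomorphic_on_subset[OF w d(2)])+
  then obtain C W where C: "\<And>s. s \<in> cball x d \<Longrightarrow> norm (c s) \<le> C"
    and W: "\<And>s. s \<in> cball x d \<Longrightarrow> norm (w s) \<le> W"
    unfolding bounded_iff by (metis imageI)
  have "0 \<le> W" using order_trans[OF norm_ge_zero W[of x]] d by simp
  obtain K where K: "K > 0"
    "\<And>C W c w b k. norm c \<le> C \<Longrightarrow> norm w \<le> W \<Longrightarrow>
       norm (jackson_coeff q c w k * b ^ k) \<le>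
         exp (C / (1 - norm q)) * K * exp (C * W / (1 - norm q)) * (\<Prod>j<k. (W * norm b) * norm q ^ j)"
    using jackson_coeff_bound by blast
  have "uniform_limit (cball x d) (\<lambda>n s. \<Sum>k<n. jackson_coeff q (c s) (w s) k * b ^ k)
          (\<lambda>s. jackson q b (c s) (w s)) sequentially"
    unfolding jackson_def
    by (rule Weierstrass_m_test[OF K(2)[OF C W]])
       (auto intro!: summable_mult summable_prod_power q mult_nonneg_nonneg \<open>0 \<le> W\<close>)
  with d show "\<exists>d>0. cball x d \<subseteq> S \<and> uniform_limit (cball x d)
      (\<lambda>n s. \<Sum>k<n. jackson_coeff q (c s) (w s) k * b ^ k) (\<lambda>s. jackson q b (c s) (w s)) sequentially"
    by blast
qed

lemma jackson_tendsto:
  assumes "b \<longlonglongrightarrow> 0"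
  shows "(\<lambda>n. jackson q (b n) c w) \<longlonglongrightarrow> qpoch_inf q (c * w)"
proof -
  have "isCont (\<lambda>b. jackson q b c w) 0"
    unfolding jackson_def by (rule isCont_powser[where K = 1]) (use summable_jackson[of c w 1] in auto)
  moreover have "jackson q 0 c w = qpoch_inf q (c * w)"
    unfolding jackson_def using powser_zero[of "jackson_coeff q c w"] by (simp add: jackson_coeff_def)
  ultimately show ?thesis using isCont_tendsto_compose[OF _ assms, of "\<lambda>b. jackson q b c w"] by simp
qed

text \<open>Replacing b by b q multiplies the k-th coefficient by q^k. The coefficients obey a
  first-order recurrence in k with polynomial factors in q^k (fact \<open>e\<close>), which
  translates into a relation between the values at b, b q and b q^2.\<close>

lemma jackson_recurrence:
  "q * jackson q b c w = (q + c * w - q * b * w) * jackson q (b * q) c w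
     - c * w * (1 - b * q) * jackson q (b * q\<^sup>2) c w"
proof -
  let ?e = "jackson_coeff q c w"
  define J where "J b = jackson q b c w" for b
  have J: "(\<lambda>k. ?e k * b ^ k) sums J b" for b
    using summable_sums[OF summable_jackson] by (simp add: J_def jackson_def)
  have e: "?e (Suc k) * (1 - q ^ Suc k) * (q - c * w * q ^ Suc k) =
           - ?e k * w * q ^ Suc k * (1 - c * q ^ k)" for k
  proof -
    have 1: "qpoch_inf q (c * w * q ^ k) = (1 - c * w * q ^ k) * qpoch_inf q (c * w * q ^ Suc k)"
      using qpoch_inf_Suc[OF q, of "c * w * q ^ k"] by (simp add: mult_ac)
    have "(a * (1 - c * r) / (X * Y) * E * (P * (- w * r))) * Y * (q - c * w * (q * r)) =
          - (a / X * ((1 - c * w * r) * E) * P) * w * (q * r) * (1 - c * r)"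
      if "X \<noteq> 0" "Y \<noteq> 0" for a r X Y E P :: complex
    proof -
      have "(a * (1 - c * r) / (X * Y) * E * (P * (- w * r))) * Y =
            a * (1 - c * r) / X * E * (P * (- w * r))"
        using that by simp
      moreover have "(1 - c * w * r) * q = q - c * w * (q * r)" by (simp add: algebra_simps)
      ultimately show ?thesis by (simp add: mult_ac)
    qed
    hence "(qpoch q c k * (1 - c * q ^ k) / (qpoch q q k * (1 - q ^ Suc k)) *
           qpoch_inf q (c * w * q ^ Suc k) * ((\<Prod>j<k. - w * q ^ j) * (- w * q ^ k))) *
          (1 - q ^ Suc k) * (q - c * w * (q * q ^ k)) =
          - (qpoch q c k / qpoch q q k * ((1 - c * w * q ^ k) * qpoch_inf q (c * w * q ^ Suc k)) *
             (\<Prod>j<k. - w * q ^ j)) * w * (q * q ^ k) * (1 - c * q ^ k)"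
      using one_minus_power_nonzero[OF q, of k] qpoch_q_nonzero[OF q, of k] by blast
    thus ?thesis
      unfolding jackson_coeff_def 1 qpoch_Suc prod.lessThan_Suc by (simp add: mult_ac)
  qed
  have q2: "(q\<^sup>2) ^ k = (q ^ k)\<^sup>2" for k
    by (simp add: power_mult[symmetric] mult.commute)
  \<comment> \<open>The factors come from q - (q + c w) X + c w X^2 = (1 - X) (q - c w X) at X =
    q^k.\<close>
  define d where "d k = ?e k * b ^ k * (1 - q ^ k) * (q - c * w * q ^ k)" for k
  have "(\<lambda>k. q * (?e k * b ^ k) - (q + c * w) * (?e k * (b * q) ^ k)
             + c * w * (?e k * (b * q\<^sup>2) ^ k))
        sums (q * J b - (q + c * w) * J (b * q) + c * w * J (b * q\<^sup>2))"
    by (intro sums_add sums_diff sums_mult J)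
  also have "(\<lambda>k. q * (?e k * b ^ k) - (q + c * w) * (?e k * (b * q) ^ k)
             + c * w * (?e k * (b * q\<^sup>2) ^ k)) = d"
    unfolding d_def power_mult_distrib q2 by (rule ext) algebra
  finally have d: "d sums (q * J b - (q + c * w) * J (b * q) + c * w * J (b * q\<^sup>2))" .
  have "(\<lambda>k. - (q * b * w) * (?e k * (b * q) ^ k) + (c * w * b * q) * (?e k * (b * q\<^sup>2) ^ k))
        sums (- (q * b * w) * J (b * q) + (c * w * b * q) * J (b * q\<^sup>2))"
    by (intro sums_add sums_mult J)
  also have "(\<lambda>k. - (q * b * w) * (?e k * (b * q) ^ k) + (c * w * b * q) * (?e k * (b * q\<^sup>2) ^ k))
             = (\<lambda>k. d (Suc k))"
  proof
    fix k
    have "d (Suc k) = b ^ Suc k * (?e (Suc k) * (1 - q ^ Suc k) * (q - c * w * q ^ Suc k))"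
      by (simp add: d_def mult_ac)
    also have "\<dots> = - (q * b * w) * (?e k * (b * q) ^ k) + (c * w * b * q) * (?e k * (b * q\<^sup>2) ^ k)"
      unfolding e unfolding power_mult_distrib q2 power_Suc by algebra
    finally show "- (q * b * w) * (?e k * (b * q) ^ k) + (c * w * b * q) * (?e k * (b * q\<^sup>2) ^ k)
                  = d (Suc k)" by simp
  qed
  \<comment> \<open>Shifting the index costs nothing, since the factor 1 - q^k makes
    \<open>d 0\<close> vanish.\<close>
  finally have "d sums (- (q * b * w) * J (b * q) + (c * w * b * q) * J (b * q\<^sup>2))"
    using sums_Suc_iff[of d] by (simp add: d_def)
  with d have "q * J b - (q + c * w) * J (b * q) + c * w * J (b * q\<^sup>2) =
               - (q * b * w) * J (b * q) + (c * w * b * q) * J (b * q\<^sup>2)"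
    by (rule sums_unique2)
  thus ?thesis unfolding J_def by (simp add: algebra_simps)
qed

text \<open>Jackson's transformation of a \<open>2phi1\<close> with vanishing lower parameter into a \<open>1phi1\<close>.
  Expanding \<open>(b)\<^sub>k\<close> in powers of \<open>b\<close> turns the series into a double sum, whose inner sums are
  evaluated by the \<open>q\<close>-binomial theorem; Tannery's theorem justifies the summation by rows.\<close>

lemma phi21_series_eq_jackson:
  assumes w: "norm w < 1"
  shows "phi21_series q b c w = jackson q b c w / qpoch_inf q w"
proof -
  define T where "T j m = qpoch q c j / qpoch q q j * (\<Prod>i<j. - w * q ^ i) * b ^ j *
      (qpoch q (c * q ^ j) m / qpoch q q m * w ^ m)" for j m
  obtain K where K: "K > 0" "\<And>k. norm (1 / qpoch q q k) \<le> K"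
    using inverse_qpoch_q_bounded[OF q] by blast
  define E where "E = exp (norm c / (1 - norm q)) * K"
  define P where "P j = (\<Prod>i<j. (norm w * norm b) * norm q ^ i)" for j
  have P0: "P j \<ge> 0" for j unfolding P_def by (intro prod_nonneg) auto
  have E0: "E \<ge> 0" using K by (simp add: E_def)
  have row: "T j sums (jackson_coeff q c w j * b ^ j / qpoch_inf q w)" for j
  proof -
    have "T j sums (qpoch q c j / qpoch q q j * (\<Prod>i<j. - w * q ^ i) * b ^ j *
            (qpoch_inf q (c * q ^ j * w) / qpoch_inf q w))"
      unfolding T_def by (intro sums_mult q_binomial q w)
    thus ?thesis by (simp add: jackson_coeff_def mult_ac)
  qed
  have ratio: "norm (qpoch q (c * q ^ j) m / qpoch q q m) \<le> E" for j m
  proof -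
    have "norm (c * q ^ j) \<le> norm c * 1" unfolding norm_mult norm_power
      using q by (intro mult_left_mono power_le_one) auto
    hence "norm (qpoch q (c * q ^ j) m) * norm (1 / qpoch q q m) \<le> E"
      unfolding E_def by (intro mult_mono norm_qpoch_le K q) auto
    thus ?thesis by (simp add: norm_divide)
  qed
  have T: "norm (T j m) \<le> E * P j * (E * norm w ^ m)" for j m
  proof -
    have "norm (T j m) = norm (qpoch q (c * q ^ 0) j / qpoch q q j) * P j *
            (norm (qpoch q (c * q ^ j) m / qpoch q q m) * norm w ^ m)"
      by (simp add: T_def P_def norm_mult norm_divide norm_power prod.distrib power_mult_distrib
            flip: prod_norm)
    also have "\<dots> \<le> E * P j * (E * norm w ^ m)"
      by (intro mult_mono ratio) (use P0 E0 in auto)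
    finally show ?thesis .
  qed
  \<comment> \<open>Rows are cut to the triangle j + m < N rather than to a square: the
    antidiagonals j + m = k of a triangle are complete, so the sum over \<open>j\<close> is exactly
    a partial sum of the 2phi1 series.\<close>
  define a where "a j N = (if j < N then \<Sum>m<N - j. T j m else 0)" for j N
  have bound: "norm (a j N) \<le> E * P j * (E * (1 / (1 - norm w)))" for j N
  proof (cases "j < N")
    case True
    have "norm (a j N) \<le> (\<Sum>m<N - j. E * P j * (E * norm w ^ m))"
      unfolding a_def using True T by (auto intro!: sum_norm_le)
    also have "\<dots> = E * P j * (E * (\<Sum>m<N - j. norm w ^ m))"
      by (simp add: sum_distrib_left)
    also have "(\<Sum>m<N - j. norm w ^ m) \<le> (\<Sum>m. norm w ^ m)"
      using w by (intro sum_le_suminf summable_geometric) auto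
    also have "(\<Sum>m. norm w ^ m) = 1 / (1 - norm w)"
      using w by (intro suminf_geometric) auto
    finally show ?thesis using E0 P0 by (simp add: mult_left_mono)
  next
    case False
    thus ?thesis using E0 P0 w by (simp add: a_def)
  qed
  have "((\<lambda>N. \<Sum>j. a j N) \<longlongrightarrow> (\<Sum>j. jackson_coeff q c w j * b ^ j / qpoch_inf q w)) sequentially"
  proof (intro tannerys_theorem[THEN conjunct2, THEN conjunct2])
    fix j
    have "(\<lambda>N. \<Sum>m<N. T j m) \<longlonglongrightarrow> jackson_coeff q c w j * b ^ j / qpoch_inf q w"
      using row by (simp add: sums_def)
    hence "(\<lambda>N. a j (N + Suc j)) \<longlonglongrightarrow> jackson_coeff q c w j * b ^ j / qpoch_inf q w"
      by (subst (asm) filterlim_sequentially_Suc[symmetric]) (simp add: a_def Suc_diff_le)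
    thus "(\<lambda>N. a j N) \<longlonglongrightarrow> jackson_coeff q c w j * b ^ j / qpoch_inf q w"
      by (rule LIMSEQ_offset)
  next
    show "summable (\<lambda>j. E * P j * (E * (1 / (1 - norm w))))"
      unfolding P_def by (intro summable_mult summable_mult2 summable_prod_power q) auto
  qed (use bound in \<open>auto simp: case_prod_unfold intro!: always_eventually\<close>)
  also have "(\<Sum>j. jackson_coeff q c w j * b ^ j / qpoch_inf q w) = jackson q b c w / qpoch_inf q w"
    unfolding jackson_def by (intro suminf_divide summable_jackson)
  also have "(\<lambda>N. \<Sum>j. a j N) = (\<lambda>N. \<Sum>k<N. qpoch q b k * qpoch q c k / qpoch q q k * w ^ k)"
  proof
    fix N
    have "(\<Sum>j. a j N) = (\<Sum>j<N. a j N)"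
      by (intro suminf_finite) (auto simp: a_def)
    also have "\<dots> = (\<Sum>j<N. \<Sum>m<N - j. T j m)"
      by (intro sum.cong) (auto simp: a_def)
    also have "\<dots> = (\<Sum>(j, m)\<in>(SIGMA j:{..<N}. {..<N - j}). T j m)"
      by (intro sum.Sigma) auto
    also have "(SIGMA j:{..<N}. {..<N - j}) = {(j, m). j + m < N}"
      by auto
    also have "(\<Sum>(j, m)\<in>{(j, m). j + m < N}. T j m) = (\<Sum>k<N. \<Sum>j\<le>k. T j (k - j))"
      by (rule sum.triangle_reindex)
    also have "\<dots> = (\<Sum>k<N. qpoch q b k * qpoch q c k / qpoch q q k * w ^ k)"
    proof (intro sum.cong refl)
      fix k
      have "(\<Sum>j\<le>k. T j (k - j)) =
            (\<Sum>j\<le>k. qpoch q c k * w ^ k *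
               ((\<Prod>i<j. - b * q ^ i) / (qpoch q q j * qpoch q q (k - j))))"
      proof (intro sum.cong refl)
        fix j assume "j \<in> {..k}"
        hence k: "k = j + (k - j)" by simp
        have 1: "(\<Prod>i<j. - w * q ^ i) * b ^ j = (\<Prod>i<j. - b * q ^ i) * w ^ j"
          by (induction j) (simp_all add: algebra_simps)
        have 2: "qpoch q c k = qpoch q c j * qpoch q (c * q ^ j) (k - j)"
          using qpoch_add[of q c j "k - j"] k by simp
        have 3: "w ^ k = w ^ j * w ^ (k - j)"
          using power_add[of w j "k - j"] k by simp
        have "T j (k - j) = (qpoch q c j * qpoch q (c * q ^ j) (k - j)) *
                ((\<Prod>i<j. - w * q ^ i) * b ^ j) * w ^ (k - j) / (qpoch q q j * qpoch q q (k - j))"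
          by (simp add: T_def)
        also have "\<dots> = qpoch q c k * (w ^ j * w ^ (k - j)) *
               ((\<Prod>i<j. - b * q ^ i) / (qpoch q q j * qpoch q q (k - j)))"
          unfolding 1 2[symmetric] by simp
        finally show "T j (k - j) = qpoch q c k * w ^ k *
               ((\<Prod>i<j. - b * q ^ i) / (qpoch q q j * qpoch q q (k - j)))"
          unfolding 3[symmetric] .
      qed
      also have "\<dots> = qpoch q c k * w ^ k * (qpoch q b k / qpoch q q k)"
        unfolding qpoch_div_qpoch_q_expand[OF q] sum_distrib_left ..
      finally show "(\<Sum>j\<le>k. T j (k - j)) = qpoch q b k * qpoch q c k / qpoch q q k * w ^ k"
        by simp
    qed
    finally show "(\<Sum>j. a j N) = (\<Sum>k<N. qpoch q b k * qpoch q c k / qpoch q q k * w ^ k)" .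
  qed
  finally have "(\<lambda>k. qpoch q b k * qpoch q c k / qpoch q q k * w ^ k) sums (jackson q b c w / qpoch_inf q w)"
    by (simp add: sums_def)
  thus ?thesis unfolding phi21_series_def by (simp add: sums_iff)
qed

text \<open>Existence holds because the quotient is meromorphic on the plane and equals the series
  on the unit disc. For uniqueness, the difference of two candidates vanishes near 0, hence
  everywhere off its singularities, and the convention about values at poles upgrades this to
  equality at every point.\<close>

lemma phi21_eq_remove_sings:
  "phi21 q b c = remove_sings (\<lambda>w. jackson q b c w / qpoch_inf q w)"
  unfolding phi21_def
proof (rule the_equality)
  let ?f = "\<lambda>w. jackson q b c w / qpoch_inf q w"
  have holo: "(\<lambda>w. jackson q b c w) holomorphic_on UNIV" "qpoch_inf q holomorphic_on UNIV"
    by (auto intro!: jackson_holomorphic holomorphic_intros q)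
  have mero: "?f meromorphic_on UNIV"
    using holo by (intro meromorphic_intros analytic_on_imp_meromorphic_on)
                  (auto simp: analytic_on_open)
  show f: "remove_sings ?f nicely_meromorphic_on UNIV \<and>
        (\<forall>w. norm w < 1 \<longrightarrow> remove_sings ?f w = phi21_series q b c w)"
  proof (intro conjI allI impI remove_sings_nicely_meromorphic mero)
    fix w :: complex assume w: "norm w < 1"
    have "?f holomorphic_on ball 0 1"
      by (intro holomorphic_intros holomorphic_on_subset[OF holo(1)] holomorphic_on_subset[OF holo(2)])
         (auto intro!: qpoch_inf_nonzero[OF q])
    hence "?f analytic_on {w}" using w
      by (intro analytic_at[THEN iffD2]) (auto intro!: exI[of _ "ball 0 1"])
    thus "remove_sings ?f w = phi21_series q b c w"
      by (simp add: phi21_series_eq_jackson[OF w])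
  qed
  fix h assume h: "h nicely_meromorphic_on UNIV \<and> (\<forall>w. norm w < 1 \<longrightarrow> h w = phi21_series q b c w)"
  define k where "k = remove_sings ?f"
  have hm: "h meromorphic_on UNIV" "k meromorphic_on UNIV"
    using h f unfolding k_def nicely_meromorphic_on_def by auto
  define D where "D = remove_sings (\<lambda>w. h w - k w)"
  have Dm: "(\<lambda>w. h w - k w) meromorphic_on UNIV" using hm by (intro meromorphic_intros)
  have "eventually (\<lambda>w. w \<in> ball 0 1) (at (0::complex))"
    by (intro eventually_at_in_open') auto
  hence "eventually (\<lambda>w. h w - k w = 0) (at 0)"
    by eventually_elim (use h f in \<open>auto simp: k_def\<close>)
  moreover have ev: "eventually (\<lambda>w. D w = h w - k w) (at z)" for z
    unfolding D_def by (intro eventually_remove_sings_eq_at meromorphic_on_isolated_singularity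
          meromorphic_on_subset[OF Dm]) auto
  ultimately have "eventually (\<lambda>w. D w = 0) (at 0)"
    using ev[of 0] by eventually_elim auto
  hence "frequently (\<lambda>w. D w = 0) (at 0)" by (rule eventually_frequently[rotated]) auto
  hence D0: "D w = 0" for w
    using frequently_eq_meromorphic_imp_constant[of D 0 0 UNIV w] remove_sings_nicely_meromorphic[OF Dm]
    by (auto simp: D_def)
  show "h = remove_sings ?f"
  proof
    \<comment> \<open>Two nicely meromorphic functions that agree in a punctured neighbourhood agree
      at its centre: either both have a pole and the value 0, or both are continuous there.\<close>
    fix z
    have eq: "eventually (\<lambda>w. h w = k w) (at z)"
      using ev[of z] by eventually_elim (use D0 in auto)
    have 1: "(is_pole h z \<and> h z = 0) \<or> h \<midarrow>z\<rightarrow> h z" and 2: "(is_pole k z \<and> k z = 0) \<or> k \<midarrow>z\<rightarrow> k z"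
      using h f unfolding k_def nicely_meromorphic_on_def by auto
    have 3: "is_pole h z \<longleftrightarrow> is_pole k z" "(h \<midarrow>z\<rightarrow> l) \<longleftrightarrow> (k \<midarrow>z\<rightarrow> l)" for l
      using eq by (intro is_pole_cong filterlim_cong refl; simp)+
    have "h z = k z"
    proof (cases "is_pole h z")
      case True
      hence "\<not> (h \<midarrow>z\<rightarrow> h z)" "\<not> (k \<midarrow>z\<rightarrow> k z)"
        using 3 not_tendsto_and_filterlim_at_infinity[of "at z"]
        unfolding is_pole_def by auto
      thus ?thesis using 1 2 by auto
    next
      case False
      hence "k \<midarrow>z\<rightarrow> h z" "k \<midarrow>z\<rightarrow> k z" using 1 2 3 by auto
      thus ?thesis using LIM_unique by blast
    qed
    thus "h z = remove_sings ?f z" by (simp add: k_def)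
  qed
qed

lemma phi21_eq_jackson:
  assumes "\<And>k. w * q ^ k \<noteq> 1"
  shows "phi21 q b c w = jackson q b c w / qpoch_inf q w"
proof -
  have nz: "qpoch_inf q w \<noteq> 0" using assms qpoch_inf_eq_0_iff[OF q] by auto
  have "(\<lambda>w. jackson q b c w) analytic_on {w}" "qpoch_inf q analytic_on {w}"
    by (rule analytic_on_subset[where S = UNIV];
        auto simp: analytic_on_open intro!: jackson_holomorphic holomorphic_intros q)+
  hence "(\<lambda>w. jackson q b c w / qpoch_inf q w) analytic_on {w}"
    by (intro analytic_on_divide) (use nz in auto)
  thus ?thesis unfolding phi21_eq_remove_sings by simp
qed

end

subsection \<open>The three-term recurrence\<close>

text \<open>The limit \<open>l\<close> is the fixed point of the limiting map. The error is
  multiplied by a factor of norm eventually below some r < 1 and perturbed by a null sequence, so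
  the initial values are forgotten.\<close>

lemma affine_iteration_tendsto:
  fixes x :: "nat \<Rightarrow> 'a::real_normed_field"
  assumes rec: "eventually (\<lambda>n. x (Suc n) = \<alpha> n + \<beta> n * x n) sequentially"
    and \<alpha>: "\<alpha> \<longlonglongrightarrow> a" and \<beta>: "\<beta> \<longlonglongrightarrow> b" and b: "norm b < 1"
  shows "x \<longlonglongrightarrow> a / (1 - b)"
proof -
  define l where "l = a / (1 - b)"
  have "b \<noteq> 1" using b by auto
  hence l: "a + b * l - l = 0" by (simp add: l_def field_simps)
  obtain r where r: "norm b < r" "r < 1" using b dense by blast
  hence r0: "0 < r" using norm_ge_zero[of b] by linarith
  have \<delta>: "(\<lambda>n. \<alpha> n + \<beta> n * l - l) \<longlonglongrightarrow> 0"
    unfolding l[symmetric] by (intro tendsto_intros \<alpha> \<beta>)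
  have "(\<lambda>n. x n - l) \<longlonglongrightarrow> 0"
  proof (rule tendsto_norm_zero_cancel, rule order_tendstoI)
    fix e :: real assume "e < 0"
    thus "eventually (\<lambda>n. e < norm (x n - l)) sequentially"
      by (intro always_eventually allI) (rule less_le_trans[OF _ norm_ge_zero])
  next
    fix e :: real assume e: "0 < e"
    \<comment> \<open>With perturbations below (1 - r) e/2, the excess of the error over e/2
      contracts by the factor r in each step.\<close>
    have "eventually (\<lambda>n. norm (\<alpha> n + \<beta> n * l - l) < (1 - r) * (e / 2)) sequentially"
      using r e by (intro order_tendstoD[OF tendsto_norm_zero[OF \<delta>]]) simp
    moreover have "eventually (\<lambda>n. norm (\<beta> n) < r) sequentially"
      by (rule order_tendstoD(2)[OF tendsto_norm[OF \<beta>] r(1)])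
    ultimately have "eventually (\<lambda>n. norm (x (Suc n) - l) \<le> r * norm (x n - l) + (1 - r) * (e / 2)) sequentially"
      using rec
    proof eventually_elim
      case (elim n)
      have "x (Suc n) - l = \<beta> n * (x n - l) + (\<alpha> n + \<beta> n * l - l)"
        using elim by (simp add: algebra_simps)
      hence "norm (x (Suc n) - l) \<le> norm (\<beta> n) * norm (x n - l) + norm (\<alpha> n + \<beta> n * l - l)"
        by (metis norm_mult norm_triangle_ineq)
      also have "\<dots> \<le> r * norm (x n - l) + (1 - r) * (e / 2)"
        using elim by (intro add_mono mult_right_mono) auto
      finally show ?case .
    qed
    then obtain N where N: "\<And>n. n \<ge> N \<Longrightarrow>
        norm (x (Suc n) - l) \<le> r * norm (x n - l) + (1 - r) * (e / 2)"
      by (auto simp: eventually_sequentially)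
    have bound: "norm (x (k + N) - l) - e / 2 \<le> r ^ k * (norm (x N - l) - e / 2)" for k
    proof (induction k)
      case (Suc k)
      have "norm (x (Suc k + N) - l) - e / 2 \<le> r * (norm (x (k + N) - l) - e / 2)"
        using N[of "k + N"] by (simp add: algebra_simps diff_divide_distrib)
      also have "\<dots> \<le> r * (r ^ k * (norm (x N - l) - e / 2))"
        using r0 by (intro mult_left_mono Suc.IH) auto
      finally show ?case by (simp add: mult_ac)
    qed simp
    have "(\<lambda>k. r ^ k * (norm (x N - l) - e / 2)) \<longlonglongrightarrow> 0 * (norm (x N - l) - e / 2)"
      using r r0 by (intro tendsto_intros LIMSEQ_power_zero) auto
    hence "eventually (\<lambda>k. r ^ k * (norm (x N - l) - e / 2) < e / 2) sequentially"
      using e by (intro order_tendstoD) auto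
    hence "eventually (\<lambda>k. norm (x (k + N) - l) < e) sequentially"
    proof eventually_elim
      case (elim k)
      with bound[of k] show ?case by linarith
    qed
    thus "eventually (\<lambda>n. norm (x n - l) < e) sequentially"
      by (rule eventually_sequentially_seg[THEN iffD1])
  qed
  thus ?thesis unfolding l_def by (rule LIM_zero_cancel)
qed

section \<open>The entire solutions of the contiguous relation\<close>

locale bqH =
  fixes q A a :: complex
  assumes q0: "q \<noteq> 0" and q1: "norm q < 1" and A0: "A \<noteq> 0" and a0: "a \<noteq> 0"
    and Aq: "A * q ^ n \<noteq> 1"
begin

text \<open>This is the \<open>S_m\<close> of the overview. The first parameter is A q^(m-1),
  written as a quotient because subtraction on naturals would truncate at m = 0.\<close>

definition sol :: "nat \<Rightarrow> complex \<Rightarrow> complex" where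
  "sol m L = jackson q (A * q ^ m / q) (A * L) (L / a)"

lemma sol_holomorphic: "sol m holomorphic_on UNIV"
  unfolding sol_def by (intro jackson_holomorphic holomorphic_intros) (use q1 a0 in auto)

lemma sol_holomorphic' [holomorphic_intros]:
  assumes "f holomorphic_on X"
  shows "(\<lambda>x. sol m (f x)) holomorphic_on X"
  using holomorphic_on_compose[OF assms holomorphic_on_subset[OF sol_holomorphic]]
  by (simp add: o_def)

lemma sol_0: "sol m 0 = 1"
proof -
  have "jackson_coeff q 0 0 k * b ^ k = (if k = 0 then 1 else 0)" for b k
    by (auto simp: jackson_coeff_def qpoch_inf_0[OF q1])
  hence "jackson q b 0 0 = (\<Sum>k. if k = 0 then 1 else 0)" for b
    unfolding jackson_def by presburger
  also have "(\<Sum>k. if k = (0::nat) then 1 else 0) = (1 :: complex)"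
    by (subst suminf_finite[of "{0}"]) auto
  finally have "jackson q b 0 0 = 1" for b .
  thus ?thesis by (simp add: sol_def)
qed

text \<open>As A q^(m-1) tends to 0, only the constant coefficient of the power series survives.
  This normalization at infinity identifies the minimal solution and evaluates the
  Casoratian.\<close>

lemma sol_tendsto: "(\<lambda>m. sol m L) \<longlonglongrightarrow> qpoch_inf q (A * L\<^sup>2 / a)"
proof -
  have "(\<lambda>m. A * q ^ m / q) \<longlonglongrightarrow> A * 0 / q"
    using q1 q0 by (intro tendsto_intros LIMSEQ_power_zero)
  hence "(\<lambda>m. sol m L) \<longlonglongrightarrow> qpoch_inf q (A * L * (L / a))"
    unfolding sol_def using q1 by (intro jackson_tendsto) auto
  thus ?thesis by (simp add: power2_eq_square mult_ac)
qed

lemma sol_eq_phi21: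
  assumes "\<And>k. L / a * q ^ k \<noteq> 1"
  shows "sol m L = qpoch_inf q (L / a) * phi21 q (A * q ^ m / q) (A * L) (L / a)"
proof -
  have "qpoch_inf q (L / a) \<noteq> 0" using assms qpoch_inf_eq_0_iff[OF q1, of "L / a"] by blast
  thus ?thesis by (simp add: sol_def phi21_eq_jackson[OF q1 assms])
qed

end

section \<open>Casoratian and limits of the convergents for a splitting z = L + L'\<close>

locale bqH_split = bqH +
  fixes L L' :: complex
  assumes LL': "L * L' = a * q / A"
begin

lemma L0: "L \<noteq> 0" and L'0: "L' \<noteq> 0"
  using LL' q0 A0 a0 by auto

lemma swap: "bqH_split q A a L' L"
  by unfold_locales (use LL' in \<open>simp add: mult.commute\<close>)

text \<open>The quotient form shows that the argument has modulus below 1 even for |L| = |L'|, and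
  it makes exchanging \<open>L\<close> and \<open>L'\<close> transparent.\<close>

lemma nome: "A * L\<^sup>2 / a = q * (L / L')"
proof -
  have "A * (L * L') = a * q" using LL' A0 by simp
  hence "A * L * L * L' = q * L * a" by algebra
  thus ?thesis using L'0 a0 by (simp add: field_simps power2_eq_square)
qed

text \<open>This is \<open>jackson_recurrence\<close> at b = A q^(m-1), where multiplying b by q
  raises m by one. The relation for L L' eliminates \<open>A\<close> and \<open>a\<close> from the
  coefficients except for the factor 1 - A q^m.\<close>

lemma sol_recurrence:
  "L' * sol m L = (L + L' - q ^ m) * sol (Suc m) L - L * (1 - A * q ^ m) * sol (Suc (Suc m)) L"
proof -
  have b: "A * q ^ m / q * q = A * q ^ Suc m / q" "A * q ^ m / q * q\<^sup>2 = A * q ^ Suc (Suc m) / q"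
    using q0 by (auto simp: power2_eq_square)
  have J: "q * sol m L = (q + A * L * (L / a) - q * (A * q ^ m / q) * (L / a)) * sol (Suc m) L
            - A * L * (L / a) * (1 - A * q ^ m) * sol (Suc (Suc m)) L"
    using jackson_recurrence[OF q1, of "A * q ^ m / q" "A * L" "L / a"] q0
    unfolding sol_def b by simp
  have cw: "A * L * (L / a) = q * (L / L')" using nome by (simp add: power2_eq_square mult.assoc)
  have bw: "q * (A * q ^ m / q) * (L / a) = q * (q ^ m / L')"
  proof -
    have "A * L / a = q / L'" using LL' L'0 A0 a0 by (simp add: field_simps)
    moreover have "q * (A * q ^ m / q) * (L / a) = (A * L / a) * q ^ m" using q0 by simp
    ultimately show ?thesis by simp
  qed
  have "q * (L' * sol m L) = L' * (q * sol m L)" by simp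
  also have "\<dots> = q * ((L + L' - q ^ m) * sol (Suc m) L - L * (1 - A * q ^ m) * sol (Suc (Suc m)) L)"
    unfolding J cw bw using L'0 by (simp add: field_simps)
  finally show ?thesis using q0 by simp
qed

lemma rec_b2_Suc: "rec_b2 q A a (Suc m) = L * L' * (1 - A * q ^ m)"
  by (simp add: rec_b2_def LL')

text \<open>The Casoratian obeys a first-order recurrence with factor 1 - A q^m, so its value at 0
  is (A)_inf times its limit, and the limit is known from \<open>sol_tendsto\<close>. No comparison
  of |L| and |L'| is assumed: the identity is applied on the unit circle, where they are
  equal.\<close>

lemma casoratian:
  "L * sol 1 L * sol 0 L' - L' * sol 1 L' * sol 0 L =
     (L - L') * qpoch_inf q A * (qpoch_inf q (q * (L / L')) * qpoch_inf q (q * (L' / L)))"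
proof -
  interpret sw: bqH_split q A a L' L by (rule swap)
  define C where "C m = L * sol (Suc m) L * sol m L' - L' * sol (Suc m) L' * sol m L" for m
  have step: "C m = (1 - A * q ^ m) * C (Suc m)" for m
  proof -
    have "C m = sol (Suc m) L * (L * sol m L') - sol (Suc m) L' * (L' * sol m L)"
      by (simp add: C_def)
    also have "\<dots> = (1 - A * q ^ m) * C (Suc m)"
      unfolding sol_recurrence sw.sol_recurrence by (simp add: C_def algebra_simps)
    finally show ?thesis .
  qed
  have C: "C 0 = qpoch q A m * C m" for m
    by (induction m) (auto simp: qpoch_Suc mult.assoc simp flip: step)
  have "(\<lambda>m. qpoch q A m * C m) \<longlonglongrightarrow> qpoch_inf q A *
          (L * qpoch_inf q (A * L\<^sup>2 / a) * qpoch_inf q (A * L'\<^sup>2 / a)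
           - L' * qpoch_inf q (A * L'\<^sup>2 / a) * qpoch_inf q (A * L\<^sup>2 / a))"
    unfolding C_def by (intro tendsto_intros qpoch_tendsto q1 sol_tendsto filterlim_compose[OF sol_tendsto filterlim_Suc])
  hence "C 0 = qpoch_inf q A *
          (L * qpoch_inf q (A * L\<^sup>2 / a) * qpoch_inf q (A * L'\<^sup>2 / a)
           - L' * qpoch_inf q (A * L'\<^sup>2 / a) * qpoch_inf q (A * L\<^sup>2 / a))"
    unfolding C[symmetric] using LIMSEQ_const_iff by blast
  thus ?thesis unfolding nome sw.nome by (simp add: C_def algebra_simps)
qed

lemma norm_nome_less:
  assumes "norm L \<le> norm L'"
  shows "norm (A * L\<^sup>2 / a) < 1"
proof -
  have "norm (A * L\<^sup>2 / a) = norm q * (norm L / norm L')" by (simp add: nome norm_mult norm_divide)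
  also have "\<dots> \<le> norm q * 1"
    using assms L'0 by (intro mult_left_mono) auto
  finally show ?thesis using q1 by simp
qed

text \<open>Since L (1 - A q^m) is nonzero, two consecutive zeros propagate to all larger m, against
  the nonzero limit of \<open>sol\<close>.\<close>

lemma sol_not_both_zero:
  assumes "norm L \<le> norm L'"
  shows "sol 0 L \<noteq> 0 \<or> sol 1 L \<noteq> 0"
proof (rule ccontr)
  assume "\<not> (sol 0 L \<noteq> 0 \<or> sol 1 L \<noteq> 0)"
  hence "sol m L = 0 \<and> sol (Suc m) L = 0" for m
  proof (induction m)
    case (Suc m)
    thus ?case using sol_recurrence[of m] L0 Aq[of m] by simp
  qed simp
  hence "(\<lambda>m. sol m L) = (\<lambda>_. 0)" by auto
  hence "qpoch_inf q (A * L\<^sup>2 / a) = 0" using sol_tendsto[of L] by (simp add: LIMSEQ_const_iff)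
  with qpoch_inf_nonzero[OF q1 norm_nome_less[OF assms]] show False by simp
qed

text \<open>Pincherle's argument: \<open>sol m L / L' ^ m\<close> solves the adjoint recurrence, so its pairing
  with any solution \<open>X\<close> of the three-term recurrence is constant.\<close>

lemma recurrence_solution_tendsto:
  assumes less: "norm L < norm L'"
    and X: "\<And>n. X (Suc (Suc n)) = (L + L' - q ^ Suc n) * X (Suc n) - rec_b2 q A a (Suc n) * X n"
  shows "(\<lambda>n. X n / L' ^ n) \<longlonglongrightarrow>
           ((X 1 - (L + L' - 1) * X 0) * sol 1 L / L' + X 0 * sol 0 L) /
             (qpoch_inf q (A * L\<^sup>2 / a) * (1 - L / L'))"
proof -
  define \<sigma> where "\<sigma> = qpoch_inf q (A * L\<^sup>2 / a)"
  have \<sigma>: "\<sigma> \<noteq> 0"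
    unfolding \<sigma>_def using less by (intro qpoch_inf_nonzero q1 norm_nome_less) simp
  define P where "P n = X n / L' ^ n" for n
  define K where "K = ((X 1 - (L + L' - 1) * X 0) * sol 1 L / L' + X 0 * sol 0 L)"
  have XP: "X n = P n * L' ^ n" for n using L'0 by (simp add: P_def)
  have inv: "P (Suc n) * sol (Suc n) L - L / L' * (1 - A * q ^ n) * P n * sol (Suc (Suc n)) L = K" for n
  proof (induction n)
    case 0
    have 1: "L * (1 - A) * sol 2 L = (L + L' - 1) * sol 1 L - L' * sol 0 L"
      using sol_recurrence[of 0] by (simp add: numeral_2_eq_2)
    have "P (Suc 0) * sol (Suc 0) L - L / L' * (1 - A * q ^ 0) * P 0 * sol (Suc (Suc 0)) L
          = (X 1 * sol 1 L - X 0 * (L * (1 - A) * sol 2 L)) / L'"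
      by (simp add: P_def numeral_2_eq_2 diff_divide_distrib mult_ac)
    also have "\<dots> = K" unfolding 1 K_def using L'0 by (simp add: field_simps)
    finally show ?case .
  next
    case (Suc n)
    have "P (Suc (Suc n)) * L'\<^sup>2 * L' ^ n = (L + L' - q ^ Suc n) * (P (Suc n) * L' * L' ^ n) 
             - L * L' * (1 - A * q ^ n) * (P n * L' ^ n)"
      using X[of n] unfolding XP rec_b2_Suc by (simp add: power2_eq_square mult_ac)
    also have "\<dots> = ((L + L' - q ^ Suc n) * P (Suc n) - L * (1 - A * q ^ n) * P n) * L' * L' ^ n"
      by (simp add: algebra_simps)
    finally have P: "P (Suc (Suc n)) * L' = (L + L' - q ^ Suc n) * P (Suc n) - L * (1 - A * q ^ n) * P n"
      using L'0 by (simp add: power2_eq_square)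
    have "L' * (P (Suc (Suc n)) * sol (Suc (Suc n)) L
             - L / L' * (1 - A * q ^ Suc n) * P (Suc n) * sol (Suc (Suc (Suc n))) L)
          = (P (Suc (Suc n)) * L') * sol (Suc (Suc n)) L
             - L * (1 - A * q ^ Suc n) * sol (Suc (Suc (Suc n))) L * P (Suc n)"
      using L'0 by (simp add: field_simps)
    also have "\<dots> = (L' * sol (Suc n) L) * P (Suc n) - L * (1 - A * q ^ n) * P n * sol (Suc (Suc n)) L"
      unfolding P sol_recurrence[of "Suc n"] by (simp add: algebra_simps)
    also have "\<dots> = L' * (P (Suc n) * sol (Suc n) L - L / L' * (1 - A * q ^ n) * P n * sol (Suc (Suc n)) L)"
      using L'0 by (simp add: field_simps)
    finally show ?case using Suc.IH L'0 by simp
  qed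
  have lim: "(\<lambda>n. sol (Suc n) L) \<longlonglongrightarrow> \<sigma>" "(\<lambda>n. sol (Suc (Suc n)) L) \<longlonglongrightarrow> \<sigma>"
    using LIMSEQ_Suc[OF sol_tendsto[of L]] LIMSEQ_Suc[OF LIMSEQ_Suc[OF sol_tendsto[of L]]]
    unfolding \<sigma>_def by simp_all
  \<comment> \<open>Solved for \<open>P (Suc n)\<close>, the invariant is an affine recursion whose
    multiplier tends to L / L'. This is where the strict inequality between the moduli
    enters.\<close>
  have "P \<longlonglongrightarrow> (K / \<sigma>) / (1 - L / L' * (1 - A * 0) * \<sigma> / \<sigma>)"
  proof (rule affine_iteration_tendsto)
    have "eventually (\<lambda>n. sol (Suc n) L \<noteq> 0) sequentially"
      using lim(1) \<sigma> by (rule tendsto_imp_eventually_ne)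
    thus "eventually (\<lambda>n. P (Suc n) = K / sol (Suc n) L +
            L / L' * (1 - A * q ^ n) * sol (Suc (Suc n)) L / sol (Suc n) L * P n) sequentially"
    proof eventually_elim
      case (elim n)
      thus ?case unfolding inv[of n, symmetric] using L'0 by (simp add: field_simps)
    qed
    show "norm (L / L' * (1 - A * 0) * \<sigma> / \<sigma>) < 1"
      using less L'0 \<sigma> by (simp add: norm_divide)
  qed (intro tendsto_intros lim \<sigma> LIMSEQ_power_zero q1)+
  thus ?thesis using \<sigma> unfolding P_def K_def \<sigma>_def by simp
qed

text \<open>The denominators start with 1 and z - 1, which kills the \<open>sol 1\<close> term of
  the general limit; the numerators start with 0 and 1 and keep only that term.\<close>

lemma cf_den_tendsto:
  assumes "norm L < norm L'"
  shows "(\<lambda>n. cf_den (bqH_cf_c q A a) (bqH_cf_d q (L + L')) n / L' ^ n) \<longlonglongrightarrow>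
           sol 0 L / (qpoch_inf q (A * L\<^sup>2 / a) * (1 - L / L'))"
  using recurrence_solution_tendsto[OF assms, of "cf_den (bqH_cf_c q A a) (bqH_cf_d q (L + L'))"]
  by (simp add: bqH_cf_c_def bqH_cf_d_def rec_a_def)

lemma cf_num_tendsto:
  assumes "norm L < norm L'"
  shows "(\<lambda>n. cf_num (bqH_cf_c q A a) (bqH_cf_d q (L + L')) n / L' ^ n) \<longlonglongrightarrow>
           sol 1 L / L' / (qpoch_inf q (A * L\<^sup>2 / a) * (1 - L / L'))"
  using recurrence_solution_tendsto[OF assms, of "cf_num (bqH_cf_c q A a) (bqH_cf_d q (L + L'))"]
  by (simp add: bqH_cf_c_def bqH_cf_d_def rec_a_def)

lemma limit_factor_nonzero:
  assumes "norm L < norm L'"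
  shows "qpoch_inf q (A * L\<^sup>2 / a) * (1 - L / L') \<noteq> 0"
  using qpoch_inf_nonzero[OF q1 norm_nome_less] assms L'0 by auto

lemma cf_converges:
  assumes less: "norm L < norm L'" and nz: "sol 0 L \<noteq> 0"
  shows "cf_converges_to (bqH_cf_c q A a) (bqH_cf_d q (L + L')) (sol 1 L / (L' * sol 0 L))"
  unfolding cf_converges_to_def
proof (intro conjI)
  let ?N = "cf_num (bqH_cf_c q A a) (bqH_cf_d q (L + L'))"
  let ?D = "cf_den (bqH_cf_c q A a) (bqH_cf_d q (L + L'))"
  note lim = cf_den_tendsto[OF less] cf_num_tendsto[OF less] and fac = limit_factor_nonzero[OF less]
  have "eventually (\<lambda>n. ?D n / L' ^ n \<noteq> 0) sequentially"
    by (rule tendsto_imp_eventually_ne[OF lim(1)]) (use fac nz in auto)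
  thus "eventually (\<lambda>n. ?D n \<noteq> 0) sequentially" by eventually_elim auto
  have "(\<lambda>n. (?N n / L' ^ n) / (?D n / L' ^ n)) \<longlonglongrightarrow>
          (sol 1 L / L' / (qpoch_inf q (A * L\<^sup>2 / a) * (1 - L / L'))) /
          (sol 0 L / (qpoch_inf q (A * L\<^sup>2 / a) * (1 - L / L')))"
    by (intro tendsto_divide lim) (use fac nz in auto)
  thus "(\<lambda>n. ?N n / ?D n) \<longlonglongrightarrow> sol 1 L / (L' * sol 0 L)"
    using fac L'0 by simp
qed

lemma cf_converges_infinity:
  assumes less: "norm L < norm L'" and z: "sol 0 L = 0"
  shows "cf_converges_to_infinity (bqH_cf_c q A a) (bqH_cf_d q (L + L'))"
  unfolding cf_converges_to_infinity_def
proof (intro conjI)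
  let ?N = "cf_num (bqH_cf_c q A a) (bqH_cf_d q (L + L'))"
  let ?D = "cf_den (bqH_cf_c q A a) (bqH_cf_d q (L + L'))"
  note lim = cf_den_tendsto[OF less] cf_num_tendsto[OF less] and fac = limit_factor_nonzero[OF less]
  have nz: "sol 1 L \<noteq> 0" using sol_not_both_zero z less by auto
  have "eventually (\<lambda>n. ?N n / L' ^ n \<noteq> 0) sequentially"
    by (rule tendsto_imp_eventually_ne[OF lim(2)]) (use fac nz L'0 in auto)
  thus "eventually (\<lambda>n. ?N n \<noteq> 0) sequentially" by eventually_elim auto
  have "(\<lambda>n. (?D n / L' ^ n) / (?N n / L' ^ n)) \<longlonglongrightarrow>
          (sol 0 L / (qpoch_inf q (A * L\<^sup>2 / a) * (1 - L / L'))) /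
          (sol 1 L / L' / (qpoch_inf q (A * L\<^sup>2 / a) * (1 - L / L')))"
    by (intro tendsto_divide lim) (use fac nz L'0 in auto)
  thus "(\<lambda>n. ?D n / ?N n) \<longlonglongrightarrow> 0"
    using z L'0 by simp
qed

end

subsection \<open>The Joukowski parametrization\<close>

text \<open>With L = g v / 2 and L' = g / (2 v) the sum is z, and the product g^2 / 4 equals a q / A
  for the \<open>g\<close> of the theorem. The point v = 0 corresponds to z at infinity.\<close>

definition jouk :: "complex \<Rightarrow> complex \<Rightarrow> complex" where
  "jouk g v = g / 2 * (v + 1 / v)"

definition jouk_inv :: "complex \<Rightarrow> complex \<Rightarrow> complex" where
  "jouk_inv g z = 2 * Lambda_minus g z / g"

lemma unit_disc_inverse_less: "v \<in> ball 0 1 - {0} \<Longrightarrow> norm v < norm (1 / v)" for v :: complex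
proof -
  assume v: "v \<in> ball 0 1 - {0}"
  hence "norm v * norm v < 1 * 1" by (intro mult_strict_mono) auto
  moreover have "norm v > 0" using v by simp
  ultimately show ?thesis by (simp add: norm_divide pos_less_divide_eq)
qed

text \<open>The explicit square root \<open>r\<close> of z^2 - g^2 satisfies the norm comparison
  that defines the branch. As \<open>csqrt\<close> returns \<open>r\<close> or \<open>- r\<close>,
  \<open>branch_sqrt\<close> returns \<open>r\<close> in both cases.\<close>

lemma Lambda_minus_jouk:
  assumes g: "g \<noteq> 0" and v: "v \<in> ball 0 1 - {0}"
  shows "Lambda_minus g (jouk g v) = g / 2 * v"
proof -
  define z where "z = jouk g v"
  define r where "r = g / 2 * (1 / v - v)"
  have v0: "v \<noteq> 0" using v by simp
  have zr: "(z - r) / 2 = g / 2 * v" "(z + r) / 2 = g / 2 * (1 / v)"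
    by (simp_all add: z_def r_def jouk_def algebra_simps add_divide_distrib diff_divide_distrib)
  have less: "norm ((z - r) / 2) < norm ((z + r) / 2)"
    unfolding zr norm_mult using unit_disc_inverse_less[OF v] g by (intro mult_strict_left_mono) auto
  have "(z + r) * (z - r) = 4 * (((z + r) / 2) * ((z - r) / 2))" by simp
  also have "\<dots> = g\<^sup>2" unfolding zr using v0 by (simp add: power2_eq_square)
  finally have "z\<^sup>2 - g\<^sup>2 = r\<^sup>2" by (simp add: algebra_simps power2_eq_square)
  hence "(csqrt (z\<^sup>2 - g\<^sup>2))\<^sup>2 = r\<^sup>2" by (simp only: power2_csqrt)
  hence "csqrt (z\<^sup>2 - g\<^sup>2) = r \<or> csqrt (z\<^sup>2 - g\<^sup>2) = - r" by (simp only: power2_eq_iff)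
  hence "branch_sqrt g z = r"
    using less unfolding branch_sqrt_def Let_def by auto
  thus ?thesis using zr(1) unfolding Lambda_minus_def z_def by simp
qed

lemma jouk_inv_jouk:
  assumes "g \<noteq> 0" "v \<in> ball 0 1 - {0}"
  shows "jouk_inv g (jouk g v) = v"
  using assms by (simp add: jouk_inv_def Lambda_minus_jouk)

lemma inj_on_jouk: "g \<noteq> 0 \<Longrightarrow> inj_on (jouk g) (ball 0 1 - {0})"
  by (rule inj_on_inverseI[of _ "jouk_inv g"]) (rule jouk_inv_jouk)

lemma jouk_holomorphic: "0 \<notin> S \<Longrightarrow> jouk g holomorphic_on S"
  unfolding jouk_def[abs_def] by (intro holomorphic_intros) auto

lemma jouk_image:
  assumes g: "g \<noteq> 0"
  shows "jouk g ` (ball 0 1 - {0}) = cut_domain g"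
proof (intro equalityI subsetI)
  fix z assume "z \<in> jouk g ` (ball 0 1 - {0})"
  then obtain v where v: "v \<in> ball 0 1 - {0}" and z: "z = jouk g v" by blast
  show "z \<in> cut_domain g"
  proof (rule ccontr)
    assume "z \<notin> cut_domain g"
    then obtain x :: real where x: "x \<in> {-1..1}" "z / g = of_real x"
      unfolding cut_domain_def by auto
    \<comment> \<open>The preimages of a point of the cut are \<open>u\<close> and its conjugate,
      both of modulus 1.\<close>
    define u where "u = Complex x (sqrt (1 - x\<^sup>2))"
    have "x\<^sup>2 \<le> 1" using x by (auto simp: abs_square_le_1)
    hence nu: "norm u = 1" by (simp add: u_def cmod_def)
    hence u1: "u * cnj u = 1" using complex_norm_square[of u] by simp
    have u2: "u + cnj u = 2 * of_real x" by (simp add: u_def complex_eq_iff)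
    have v0: "v \<noteq> 0" using v by simp
    have "v + 1 / v = 2 * of_real x" using x(2) g unfolding z jouk_def by simp
    hence "(v + 1 / v) * v = (u + cnj u) * v" unfolding u2 by simp
    moreover have "(v + 1 / v) * v = v * v + 1" using v0 by (simp add: distrib_right)
    ultimately have eq: "v * v + 1 = (u + cnj u) * v" by simp
    have "(v - u) * (v - cnj u) = (v * v + u * cnj u) - (u + cnj u) * v"
      by (simp add: algebra_simps)
    also have "\<dots> = 0" unfolding u1 eq by (rule diff_self)
    finally have "(v - u) * (v - cnj u) = 0" .
    hence "v = u \<or> v = cnj u" by simp
    hence "norm v = 1" using nu by auto
    thus False using v by simp
  qed
next
  fix z assume z: "z \<in> cut_domain g"
  define s where "s = csqrt (z\<^sup>2 - g\<^sup>2)"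
  define v where "v = (z - s) / g"
  have s: "s\<^sup>2 = z\<^sup>2 - g\<^sup>2" by (simp add: s_def)
  \<comment> \<open>The two preimages of z are inverse to each other. Off the cut neither has
    modulus 1, so exactly one lies in the disc.\<close>
  have prod: "v * ((z + s) / g) = 1"
    using s g by (simp add: v_def field_simps power2_eq_square)
  hence v0: "v \<noteq> 0" by auto
  have inv: "(z + s) / g = 1 / v" using prod v0 by (simp add: field_simps)
  have jv: "jouk g v = z" unfolding jouk_def inv[symmetric] using g by (simp add: v_def field_simps)
  have jv': "jouk g (1 / v) = z" using jv v0 by (simp add: jouk_def add.commute)
  have "norm v \<noteq> 1"
  proof
    assume n: "norm v = 1"
    hence "v * cnj v = 1" using complex_norm_square[of v] by simp
    hence "1 / v = cnj v" using v0 by (metis nonzero_mult_div_cancel_left)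
    hence "jouk g v = g * of_real (Re v)"
      by (simp add: jouk_def complex_add_cnj)
    hence "z / g = of_real (Re v)" using jv g by simp
    moreover have "Re v \<in> {-1..1}" using abs_Re_le_cmod[of v] n by auto
    ultimately show False using z by (auto simp: cut_domain_def)
  qed
  thus "z \<in> jouk g ` (ball 0 1 - {0})"
  proof (cases "norm v < 1")
    case True
    thus ?thesis using jv v0 by (intro image_eqI[of _ _ v]) auto
  next
    case False
    hence "norm (1 / v) < 1" using \<open>norm v \<noteq> 1\<close> v0 by (simp add: norm_divide)
    thus ?thesis using jv' v0 by (intro image_eqI[of _ _ "1 / v"]) auto
  qed
qed

lemma open_cut_domain:
  assumes "g \<noteq> 0" shows "open (cut_domain g)"
proof -
  have "open (jouk g ` (ball 0 1 - {0}))"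
    by (intro open_mapping_thm3 inj_on_jouk assms jouk_holomorphic open_delete open_ball) simp
  thus ?thesis by (simp only: jouk_image[OF assms])
qed

text \<open>The inverse of an injective holomorphic map is holomorphic; this bypasses the branch cut
  of \<open>csqrt\<close>, across which \<open>branch_sqrt\<close> changes sign to
  compensate.\<close>

lemma jouk_inv_holomorphic:
  assumes "g \<noteq> 0"
  shows "jouk_inv g holomorphic_on cut_domain g"
proof -
  have "jouk g holomorphic_on (ball 0 1 - {0})" by (rule jouk_holomorphic) simp
  then obtain h where h0: "h holomorphic_on jouk g ` (ball 0 1 - {0})"
    and "\<And>v. v \<in> ball 0 1 - {0} \<Longrightarrow> deriv (jouk g) v * deriv h (jouk g v) = 1"
    and h: "\<And>v. v \<in> ball 0 1 - {0} \<Longrightarrow> h (jouk g v) = v"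
    by (rule holomorphic_has_inverse[OF _ open_delete[OF open_ball] inj_on_jouk[OF assms]])
       (rule that; assumption)
  from h0 have h1: "h holomorphic_on cut_domain g" unfolding jouk_image[OF assms] .
  have "h z = jouk_inv g z" if z: "z \<in> cut_domain g" for z
  proof -
    obtain v where v: "v \<in> ball 0 1 - {0}" "z = jouk g v"
      using z unfolding jouk_image[OF assms, symmetric] by blast
    show ?thesis unfolding v(2) h[OF v(1)] jouk_inv_jouk[OF assms v(1)] ..
  qed
  with h1 show ?thesis by (rule holomorphic_transform)
qed

lemma jouk_inv_mem:
  assumes "g \<noteq> 0" "z \<in> cut_domain g"
  shows "jouk_inv g z \<in> ball 0 1 - {0}" "jouk g (jouk_inv g z) = z"
proof -
  obtain v where v: "v \<in> ball 0 1 - {0}" "z = jouk g v"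
    using assms(2) unfolding jouk_image[OF assms(1), symmetric] by blast
  have "jouk_inv g z = v" unfolding v(2) by (rule jouk_inv_jouk[OF assms(1) v(1)])
  thus "jouk_inv g z \<in> ball 0 1 - {0}" "jouk g (jouk_inv g z) = z"
    using v by simp_all
qed

text \<open>Finitely many bad parameters give finitely many bad points, which a punctured
  neighbourhood avoids. \<open>F\<close> is used for poles of \<open>phi21\<close> and zeros of
  \<open>sl\<close>.\<close>

lemma eventually_jouk_inv_notin:
  assumes g: "g \<noteq> 0" and z: "z \<in> cut_domain g" and F: "finite (F \<inter> ball 0 1)"
  shows "eventually (\<lambda>w. w \<in> cut_domain g \<and> jouk_inv g w \<notin> F) (at z)"
proof -
  have "finite (jouk g ` (F \<inter> ball 0 1))" using F by simp
  hence "eventually (\<lambda>w. w \<in> cut_domain g - (jouk g ` (F \<inter> ball 0 1) - {z})) (at z)"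
    using open_cut_domain[OF g] z by (intro eventually_at_in_open') (auto intro!: open_Diff finite_imp_closed)
  moreover have "eventually (\<lambda>w. w \<noteq> z) (at z)" by (rule eventually_neq_at_within)
  ultimately show ?thesis
  proof eventually_elim
    case (elim w)
    hence w: "w \<in> cut_domain g" "w \<notin> jouk g ` (F \<inter> ball 0 1)" by auto
    have "jouk_inv g w \<notin> F"
    proof
      assume "jouk_inv g w \<in> F"
      hence "jouk g (jouk_inv g w) \<in> jouk g ` (F \<inter> ball 0 1)"
        using jouk_inv_mem(1)[OF g w(1)] by blast
      thus False using w(2) jouk_inv_mem(2)[OF g w(1)] by simp
    qed
    thus ?case using w by blast
  qed
qed

section \<open>The continued fraction as a meromorphic function of the parameter
  \<open>v\<close>\<close>

locale bqH_param = bqH +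
  fixes g :: complex
  assumes g2: "g\<^sup>2 = 4 * (a * q / A)"
begin

lemma g0: "g \<noteq> 0" using g2 q0 a0 A0 by auto

text \<open>\<open>sl v\<close> and \<open>sr v\<close> are, up to common factors, denominator and numerator of the continued
  fraction at \<open>z = jouk g v\<close>; they are entire in \<open>v\<close>.\<close>

definition sl :: "complex \<Rightarrow> complex" where "sl v = sol 0 (g / 2 * v)"
definition sr :: "complex \<Rightarrow> complex" where "sr v = sol 1 (g / 2 * v)"
definition ratio :: "complex \<Rightarrow> complex" where "ratio v = 2 / g * v * sr v / sl v"

lemma split: "v \<noteq> 0 \<Longrightarrow> bqH_split q A a (g / 2 * v) (g / 2 * (1 / v))"
  by unfold_locales (use g2 in \<open>simp add: power2_eq_square field_simps\<close>)

lemma sl_holomorphic [holomorphic_intros]: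
  "f holomorphic_on X \<Longrightarrow> (\<lambda>x. sl (f x)) holomorphic_on X"
  and sr_holomorphic [holomorphic_intros]:
  "f holomorphic_on X \<Longrightarrow> (\<lambda>x. sr (f x)) holomorphic_on X"
  unfolding sl_def sr_def by (rule sol_holomorphic', intro holomorphic_intros, assumption)+

lemma sl_0: "sl 0 = 1" by (simp add: sl_def sol_0)

lemma sr_nonzero:
  assumes "v \<noteq> 0" "norm v \<le> 1" "sl v = 0"
  shows "sr v \<noteq> 0"
proof -
  interpret bqH_split q A a "g / 2 * v" "g / 2 * (1 / v)" by (rule split) fact
  have "norm v * norm v \<le> 1 * 1" using assms(2) by (intro mult_mono) auto
  hence "norm v \<le> norm (1 / v)" using assms(1) by (simp add: norm_divide field_simps)
  hence "norm (g / 2 * v) \<le> norm (g / 2 * (1 / v))" unfolding norm_mult by (intro mult_left_mono) auto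
  thus ?thesis using sol_not_both_zero assms(3) unfolding sl_def sr_def by auto
qed

text \<open>The value 1 at 0 rules out that \<open>sl\<close> vanishes identically.\<close>

lemma finite_sl_zeros: "finite {v \<in> cball 0 r. sl v = 0}"
proof (cases "sl constant_on UNIV")
  case True
  then obtain c where "\<And>v. sl v = c" unfolding constant_on_def by auto
  hence "sl v = 1" for v using sl_0 by metis
  thus ?thesis by simp
next
  case False
  thus ?thesis
    by (intro holomorphic_compact_finite_zeros[of sl UNIV]) (auto intro!: holomorphic_intros)
qed

text \<open>Each k contributes one point, and because |q|^k tends to 0 only finitely many of these
  points lie in the disc.\<close>

lemma finite_phi_poles: "finite {v \<in> cball 0 r. \<exists>k. g / 2 * v / a * q ^ k = 1}"
proof -
  have "(\<lambda>k. norm g / 2 * r / norm a * norm q ^ k) \<longlonglongrightarrow> norm g / 2 * r / norm a * 0"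
    using q1 by (intro tendsto_intros LIMSEQ_power_zero) simp
  hence "eventually (\<lambda>k. norm g / 2 * r / norm a * norm q ^ k < 1) sequentially"
    by (intro order_tendstoD) auto
  then obtain N where N: "\<And>k. k \<ge> N \<Longrightarrow> norm g / 2 * r / norm a * norm q ^ k < 1"
    by (auto simp: eventually_sequentially)
  have "{v \<in> cball 0 r. \<exists>k. g / 2 * v / a * q ^ k = 1} \<subseteq> (\<lambda>k. 2 * a / (g * q ^ k)) ` {..<N}"
  proof
    fix v assume "v \<in> {v \<in> cball 0 r. \<exists>k. g / 2 * v / a * q ^ k = 1}"
    then obtain k where v: "norm v \<le> r" and k: "g / 2 * v / a * q ^ k = 1" by auto
    have "1 = norm (g / 2 * v / a * q ^ k)" by (simp only: k norm_one)
    also have "\<dots> = norm g / 2 * norm v / norm a * norm q ^ k"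
      by (simp add: norm_mult norm_divide norm_power)
    also have "\<dots> \<le> norm g / 2 * r / norm a * norm q ^ k"
      using v by (intro mult_right_mono divide_right_mono mult_left_mono) auto
    finally have "k < N" using N[of k] by (meson not_less)
    moreover have "v * (g * q ^ k) = 2 * a" using k a0 by (simp add: field_simps)
    hence "v = 2 * a / (g * q ^ k)" using g0 q0 by (simp add: nonzero_eq_divide_eq)
    ultimately show "v \<in> (\<lambda>k. 2 * a / (g * q ^ k)) ` {..<N}" by blast
  qed
  thus ?thesis by (rule finite_subset) auto
qed

text \<open>Only the common factor (L/a)_inf has to be nonzero. Where the denominator vanishes both
  sides are 0 by the division convention.\<close>

lemma bqH_ratio_eq:
  assumes "\<And>k. Lambda_minus g z / a * q ^ k \<noteq> 1"
  shows "bqH_ratio q A a g z = ratio (jouk_inv g z)"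
proof -
  define L where "L = Lambda_minus g z"
  have L: "g / 2 * jouk_inv g z = L" using g0 by (simp add: jouk_inv_def L_def)
  have nz: "qpoch_inf q (L / a) \<noteq> 0" using assms qpoch_inf_eq_0_iff[OF q1, of "L / a"] by (auto simp: L_def)
  have "sl (jouk_inv g z) = qpoch_inf q (L / a) * phi21 q (A / q) (A * L) (L / a)"
    and "sr (jouk_inv g z) = qpoch_inf q (L / a) * phi21 q A (A * L) (L / a)"
    using sol_eq_phi21[of L 0, OF assms[folded L_def]] sol_eq_phi21[of L 1, OF assms[folded L_def]] q0
    unfolding sl_def sr_def L by simp_all
  moreover have "2 / g * jouk_inv g z = A * L / (a * q)"
  proof -
    have "2 / g * jouk_inv g z = 4 * L / g\<^sup>2" using g0 unfolding L[symmetric] by (simp add: field_simps power2_eq_square)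
    thus ?thesis unfolding g2 using A0 a0 q0 by (simp add: field_simps)
  qed
  ultimately show ?thesis using nz unfolding bqH_ratio_def Let_def ratio_def L_def[symmetric] by (simp add: mult.assoc)
qed

lemma eventually_bqH_ratio_eq:
  assumes "z \<in> cut_domain g"
  shows "eventually (\<lambda>w. w \<in> cut_domain g \<and> bqH_ratio q A a g w = ratio (jouk_inv g w)) (at z)"
proof -
  define F where "F = {v \<in> cball 0 1. \<exists>k. g / 2 * v / a * q ^ k = 1}"
  have "finite (F \<inter> ball 0 1)" using finite_phi_poles[of 1] by (simp add: F_def)
  from eventually_jouk_inv_notin[OF g0 assms this] show ?thesis
  proof eventually_elim
    case (elim w)
    have "Lambda_minus g w = g / 2 * jouk_inv g w" using g0 by (simp add: jouk_inv_def)
    moreover have "jouk_inv g w \<in> cball 0 1" using elim jouk_inv_mem[OF g0, of w] by simp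
    ultimately have "Lambda_minus g w / a * q ^ k \<noteq> 1" for k using elim by (auto simp only: F_def mem_Collect_eq)
    from bqH_ratio_eq[OF this] elim show ?case by simp
  qed
qed

lemma isCont_jouk_inv: "z \<in> cut_domain g \<Longrightarrow> isCont (jouk_inv g) z"
  using holomorphic_on_imp_continuous_on[OF jouk_inv_holomorphic[OF g0]] open_cut_domain[OF g0]
  by (simp add: continuous_on_eq_continuous_at)

lemma isCont_sl: "isCont sl v" and isCont_sr: "isCont sr v"
  using sl_holomorphic[of "\<lambda>x. x" UNIV] sr_holomorphic[of "\<lambda>x. x" UNIV]
  by (auto dest!: holomorphic_on_imp_continuous_on simp: continuous_on_eq_continuous_at)

lemma bqH_ratio_tendsto:
  assumes z: "z \<in> cut_domain g" and nz: "sl (jouk_inv g z) \<noteq> 0"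
  shows "bqH_ratio q A a g \<midarrow>z\<rightarrow> ratio (jouk_inv g z)"
proof -
  have "isCont (\<lambda>w. ratio (jouk_inv g w)) z"
    unfolding ratio_def
    by (intro continuous_intros isCont_o2[OF _ isCont_sl] isCont_o2[OF _ isCont_sr] isCont_jouk_inv z nz)
  hence "(\<lambda>w. ratio (jouk_inv g w)) \<midarrow>z\<rightarrow> ratio (jouk_inv g z)" by (simp add: isCont_def)
  moreover have "eventually (\<lambda>w. ratio (jouk_inv g w) = bqH_ratio q A a g w) (at z)"
    using eventually_bqH_ratio_eq[OF z] by eventually_elim auto
  ultimately show ?thesis using tendsto_cong by force
qed

text \<open>A zero of \<open>sl\<close> cannot be cancelled, since \<open>sr\<close> is nonzero
  there by \<open>sr_nonzero\<close> and v is not 0.\<close>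

lemma is_pole_bqH_ratio_iff:
  assumes z: "z \<in> cut_domain g"
  shows "is_pole (bqH_ratio q A a g) z \<longleftrightarrow> sl (jouk_inv g z) = 0"
proof
  assume pole: "is_pole (bqH_ratio q A a g) z"
  show "sl (jouk_inv g z) = 0"
  proof (rule ccontr)
    assume "sl (jouk_inv g z) \<noteq> 0"
    from bqH_ratio_tendsto[OF z this] pole show False
      unfolding is_pole_def by (meson at_neq_bot not_tendsto_and_filterlim_at_infinity)
  qed
next
  assume 0: "sl (jouk_inv g z) = 0"
  note v = jouk_inv_mem[OF g0 z]
  have "is_pole (\<lambda>w. (2 / g * jouk_inv g w * sr (jouk_inv g w)) / sl (jouk_inv g w)) z"
  proof (rule is_pole_divide)
    show "isCont (\<lambda>w. 2 / g * jouk_inv g w * sr (jouk_inv g w)) z"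
      by (intro continuous_intros isCont_o2[OF _ isCont_sr] isCont_jouk_inv z g0)
    show "2 / g * jouk_inv g z * sr (jouk_inv g z) \<noteq> 0"
      using sr_nonzero[of "jouk_inv g z"] v 0 g0 by auto
    have "isCont (\<lambda>w. sl (jouk_inv g w)) z"
      by (intro continuous_intros isCont_o2[OF _ isCont_sl] isCont_jouk_inv z)
    hence "(\<lambda>w. sl (jouk_inv g w)) \<midarrow>z\<rightarrow> 0" using 0 by (simp add: isCont_def)
    moreover have "eventually (\<lambda>w. sl (jouk_inv g w) \<noteq> 0) (at z)"
    proof -
      have "finite ({v \<in> cball 0 1. sl v = 0} \<inter> ball 0 1)" using finite_sl_zeros by simp
      from eventually_jouk_inv_notin[OF g0 z this] show ?thesis
      proof eventually_elim
        case (elim w)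
        thus ?case using jouk_inv_mem[OF g0, of w] by auto
      qed
    qed
    ultimately show "filterlim (\<lambda>w. sl (jouk_inv g w)) (at 0) (at z)"
      by (simp add: filterlim_at)
  qed
  moreover have "eventually (\<lambda>w. (2 / g * jouk_inv g w * sr (jouk_inv g w)) / sl (jouk_inv g w)
                    = bqH_ratio q A a g w) (at z)"
    using eventually_bqH_ratio_eq[OF z] by eventually_elim (auto simp: ratio_def)
  ultimately show "is_pole (bqH_ratio q A a g) z" by (rule is_pole_transform) simp
qed

lemma remove_sings_bqH_ratio:
  "z \<in> cut_domain g \<Longrightarrow> sl (jouk_inv g z) \<noteq> 0 \<Longrightarrow>
     remove_sings (bqH_ratio q A a g) z = ratio (jouk_inv g z)"
  by (rule remove_sings_eqI[OF bqH_ratio_tendsto])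

lemma bqH_poles_eq: "bqH_poles q A a g = jouk g ` {v \<in> ball 0 1. sl v = 0}"
proof -
  have "{v \<in> ball 0 1. sl v = 0} = {v \<in> ball 0 1 - {0}. sl v = 0}" using sl_0 by auto
  moreover have "bqH_poles q A a g = jouk g ` {v \<in> ball 0 1 - {0}. sl v = 0}"
  proof (intro equalityI subsetI)
    fix z assume "z \<in> bqH_poles q A a g"
    hence "z \<in> cut_domain g" "sl (jouk_inv g z) = 0"
      using is_pole_bqH_ratio_iff by (auto simp: bqH_poles_def)
    thus "z \<in> jouk g ` {v \<in> ball 0 1 - {0}. sl v = 0}"
      using jouk_inv_mem[OF g0, of z] by (intro image_eqI[of _ _ "jouk_inv g z"]) auto
  next
    fix z assume "z \<in> jouk g ` {v \<in> ball 0 1 - {0}. sl v = 0}"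
    then obtain v where v: "v \<in> ball 0 1 - {0}" "sl v = 0" "z = jouk g v" by blast
    moreover have "z \<in> cut_domain g" unfolding jouk_image[OF g0, symmetric] using v by blast
    ultimately show "z \<in> bqH_poles q A a g"
      using is_pole_bqH_ratio_iff jouk_inv_jouk[OF g0 v(1)] by (auto simp: bqH_poles_def)
  qed
  ultimately show ?thesis by simp
qed

lemma finite_bqH_poles: "finite (bqH_poles q A a g)"
  unfolding bqH_poles_eq using finite_sl_zeros[of 1]
  by (intro finite_imageI) (rule finite_subset[rotated], auto)

lemma cf_convergence:
  assumes z: "z \<in> cut_domain g"
  shows "sl (jouk_inv g z) \<noteq> 0 \<Longrightarrow>
           cf_converges_to (bqH_cf_c q A a) (bqH_cf_d q z) (ratio (jouk_inv g z))"
    and "sl (jouk_inv g z) = 0 \<Longrightarrow> cf_converges_to_infinity (bqH_cf_c q A a) (bqH_cf_d q z)"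
proof -
  define v where "v = jouk_inv g z"
  note v = jouk_inv_mem[OF g0 z, folded v_def]
  interpret bqH_split q A a "g / 2 * v" "g / 2 * (1 / v)" using v by (intro split) auto
  have less: "norm (g / 2 * v) < norm (g / 2 * (1 / v))"
    unfolding norm_mult using unit_disc_inverse_less[OF v(1)] g0 by (intro mult_strict_left_mono) auto
  have z': "g / 2 * v + g / 2 * (1 / v) = z"
    using v(2) unfolding jouk_def by (simp only: distrib_left)
  have "sol 1 (g / 2 * v) / (g / 2 * (1 / v) * sol 0 (g / 2 * v)) = ratio v"
    using v by (simp add: ratio_def sl_def sr_def)
  thus "sl (jouk_inv g z) \<noteq> 0 \<Longrightarrow>
           cf_converges_to (bqH_cf_c q A a) (bqH_cf_d q z) (ratio (jouk_inv g z))"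
    using cf_converges[OF less] unfolding z' by (simp add: sl_def v_def)
  show "sl (jouk_inv g z) = 0 \<Longrightarrow> cf_converges_to_infinity (bqH_cf_c q A a) (bqH_cf_d q z)"
    using cf_converges_infinity[OF less] unfolding z' by (simp add: sl_def v_def)
qed

end

subsection \<open>The jump across the cut\<close>

text \<open>The residue belongs to the differential F dz and is invariant under local
  biholomorphisms. It carries the pole terms from z to v; poles of any order are allowed, because
  zeros of \<open>sl\<close> in the disc may be multiple.\<close>

lemma residue_conformal:
  assumes F: "F holomorphic_on ball (h p) \<rho> - {h p}" and \<rho>: "\<rho> > 0"
    and h: "h holomorphic_on S" and S: "open S" "p \<in> S" and h': "deriv h p \<noteq> 0"
  shows "residue (\<lambda>v. deriv h v * F (h v)) p = residue F (h p)"
proof -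
  define B where "B = ball (h p) \<rho>"
  have conth: "continuous_on S h" using h by (rule holomorphic_on_imp_continuous_on)
  obtain r1 where r1: "r1 > 0" "ball p r1 \<subseteq> S" "inj_on h (ball p r1)"
    by (rule has_complex_derivative_locally_injective[OF h S(2,1) h'])
  have "open (S \<inter> h -` B)"
    using conth S(1) by (intro continuous_open_preimage) (auto simp: B_def)
  moreover have "p \<in> S \<inter> h -` B" using S(2) \<rho> by (simp add: B_def)
  ultimately obtain r2 where r2: "r2 > 0" "ball p r2 \<subseteq> S \<inter> h -` B"
    using open_contains_ball by blast
  define r0 where "r0 = min r1 r2"
  have r0: "r0 > 0" using r1 r2 by (simp add: r0_def)
  have sub: "ball p r0 \<subseteq> S" and hB: "\<And>v. v \<in> ball p r0 \<Longrightarrow> h v \<in> B"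
    and inj: "\<And>v. v \<in> ball p r0 \<Longrightarrow> v \<noteq> p \<Longrightarrow> h v \<noteq> h p"
    using r1 r2 r0 unfolding r0_def inj_on_def by auto
  define \<gamma> where "\<gamma> = circlepath p (r0 / 2)"
  have img: "path_image \<gamma> \<subseteq> ball p r0 - {p}" using r0 by (auto simp: \<gamma>_def)
  have hr: "h holomorphic_on ball p r0" using h sub by (rule holomorphic_on_subset)
  have hol: "(\<lambda>v. deriv h v * G (h v)) holomorphic_on ball p r0 - {p}"
    if "G holomorphic_on B - {h p}" for G
  proof -
    have "(\<lambda>v. G (h v)) holomorphic_on ball p r0 - {p}"
    proof -
      have "h ` (ball p r0 - {p}) \<subseteq> B - {h p}" using hB inj by auto
      moreover have "h holomorphic_on ball p r0 - {p}" using hr by (rule holomorphic_on_subset) auto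
      ultimately show ?thesis
        using holomorphic_on_compose_gen[of h "ball p r0 - {p}" G "B - {h p}"] that
        by (simp add: o_def)
    qed
    moreover have "deriv h holomorphic_on ball p r0 - {p}"
      using holomorphic_deriv[OF hr] by (auto intro: holomorphic_on_subset)
    ultimately show ?thesis by (intro holomorphic_on_mult)
  qed
  have int: "contour_integral (h \<circ> \<gamma>) G = 2 * pi * \<i> * residue (\<lambda>v. deriv h v * G (h v)) p"
    if "G holomorphic_on B - {h p}" for G
  proof -
    have "contour_integral (h \<circ> \<gamma>) G = contour_integral \<gamma> (\<lambda>w. deriv h w * G (h w))"
      using img hr by (intro contour_integral_comp_analyticW[where s = "ball p r0"])
                      (auto simp: analytic_on_open \<gamma>_def)
    also have "\<dots> = 2 * pi * \<i> * residue (\<lambda>v. deriv h v * G (h v)) p"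
      unfolding \<gamma>_def
      by (intro contour_integral_unique base_residue[OF _ _ _ hol[OF that]]) (use r0 in auto)
    finally show ?thesis .
  qed
  have valid: "valid_path (h \<circ> \<gamma>)"
    using img hr by (intro valid_path_compose_holomorphic[where S = "ball p r0"]) (auto simp: \<gamma>_def)
  have img': "path_image (h \<circ> \<gamma>) \<subseteq> B - {h p}"
  proof -
    have "h ` (ball p r0 - {p}) \<subseteq> B - {h p}" using hB inj by auto
    thus ?thesis unfolding path_image_compose using image_mono[OF img, of h] by (rule order_trans[rotated])
  qed
  have loop: "pathfinish (h \<circ> \<gamma>) = pathstart (h \<circ> \<gamma>)"
    unfolding pathfinish_compose pathstart_compose by (simp add: \<gamma>_def)
  \<comment> \<open>The same change of variables applied to 1 / (w - h p) computes the winding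
    number of the image loop: the pullback has a simple pole with residue 1.\<close>
  have "(\<lambda>w. 1 / (w - h p)) holomorphic_on B - {h p}"
    by (intro holomorphic_intros) auto
  note hol1 = hol[OF this] and int1 = int[OF this]
  have "residue (\<lambda>v. deriv h v * (1 / (h v - h p))) p = 1"
  proof (rule residue_simple'[OF _ _ hol1])
    have "isCont (deriv h) p"
      using holomorphic_on_imp_continuous_on[OF holomorphic_deriv[OF h S(1)]] S
      by (simp add: continuous_on_eq_continuous_at)
    hence 1: "(deriv h \<longlongrightarrow> deriv h p) (at p)" by (simp add: isCont_def)
    have "(h has_field_derivative deriv h p) (at p)"
      using h S by (rule holomorphic_derivI)
    hence 2: "((\<lambda>v. (h v - h p) / (v - p)) \<longlongrightarrow> deriv h p) (at p)"
      by (simp add: has_field_derivative_iff)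
    have "((\<lambda>v. deriv h v / ((h v - h p) / (v - p))) \<longlongrightarrow> deriv h p / deriv h p) (at p)"
      by (intro tendsto_divide 1 2 h')
    thus "((\<lambda>v. deriv h v * (1 / (h v - h p)) * (v - p)) \<longlongrightarrow> 1) (at p)"
      using h' by simp
  qed (use r0 in auto)
  hence "contour_integral (h \<circ> \<gamma>) (\<lambda>w. 1 / (w - h p)) = 2 * pi * \<i>"
    unfolding int1 by simp
  hence wind: "winding_number (h \<circ> \<gamma>) (h p) = 1"
    by (subst winding_number_valid_path[OF valid]) (use img' in auto)
  have "contour_integral (h \<circ> \<gamma>) F =
          2 * pi * \<i> * (\<Sum>w\<in>{h p}. winding_number (h \<circ> \<gamma>) w * residue F w)"
  proof (rule Residue_theorem[where S = B])
    show "\<forall>z. z \<notin> B \<longrightarrow> winding_number (h \<circ> \<gamma>) z = 0"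
      using img' by (auto intro!: winding_number_zero_outside[of _ B] valid_path_imp_path valid loop
                          simp: B_def)
  qed (use F img' in \<open>auto simp: B_def intro: valid loop\<close>)
  with int[OF F[folded B_def]] wind show ?thesis by simp
qed

text \<open>The integral of c / (x - x1) diverges logarithmically. \<open>F\<close> leaves room for
  finitely many points where \<open>h\<close> has accidental values.\<close>

lemma not_integrable_pole:
  fixes h :: "real \<Rightarrow> real"
  assumes int: "h integrable_on {x1..x1 + \<delta>}" and nonneg: "\<And>x. h x \<ge> 0"
    and \<delta>: "\<delta> > 0" and c: "c > 0" and F: "finite F"
    and lower: "\<And>x. x \<in> {x1<..x1 + \<delta>} - F \<Longrightarrow> c / (x - x1) \<le> h x"
  shows False
proof -
  define I where "I = integral {x1..x1 + \<delta>} h"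
  have I: "I \<ge> 0" unfolding I_def using int nonneg by (intro integral_nonneg) auto
  \<comment> \<open>Chosen so that c ln(\<delta> / \<epsilon>) = I + 1, which exceeds the integral
    of \<open>h\<close>.\<close>
  define \<epsilon> where "\<epsilon> = \<delta> * exp (- (I + 1) / c)"
  have "- (I + 1) / c < 0" using I c by (simp add: divide_neg_pos)
  hence \<epsilon>: "\<epsilon> > 0" "\<epsilon> < \<delta>" using \<delta> by (auto simp: \<epsilon>_def)
  have "((\<lambda>x. c / (x - x1)) has_integral c * ln (x1 + \<delta> - x1) - c * ln (x1 + \<epsilon> - x1)) {x1 + \<epsilon>..x1 + \<delta>}"
    by (intro fundamental_theorem_of_calculus)
       (use \<epsilon> in \<open>auto intro!: derivative_eq_intros simp flip: has_real_derivative_iff_has_vector_derivative\<close>)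
  also have "c * ln (x1 + \<delta> - x1) - c * ln (x1 + \<epsilon> - x1) = I + 1"
    using \<delta> c by (simp add: \<epsilon>_def ln_mult field_simps)
  finally have 1: "((\<lambda>x. c / (x - x1)) has_integral I + 1) {x1 + \<epsilon>..x1 + \<delta>}" .
  have "h integrable_on {x1 + \<epsilon>..x1 + \<delta>}"
    using int \<epsilon> by (auto intro: integrable_on_subinterval)
  hence "(h has_integral integral {x1 + \<epsilon>..x1 + \<delta>} h) {x1 + \<epsilon>..x1 + \<delta>}"
    by (rule integrable_integral)
  hence 2: "((\<lambda>x. if x \<in> F then c / (x - x1) else h x) has_integral integral {x1 + \<epsilon>..x1 + \<delta>} h) {x1 + \<epsilon>..x1 + \<delta>}"
    by (rule has_integral_spike_finite[OF F, rotated]) auto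
  have "I + 1 \<le> integral {x1 + \<epsilon>..x1 + \<delta>} h"
    by (rule has_integral_le[OF 1 2]) (use \<epsilon> lower in auto)
  also have "\<dots> \<le> I" unfolding I_def
    using int nonneg \<epsilon> by (intro integral_subset_le) (auto intro: integrable_on_subinterval)
  finally show False by simp
qed

lemma cis_arccos: "x \<in> {-1..1} \<Longrightarrow> cis (arccos x) = Complex x (sqrt (1 - x\<^sup>2))"
  by (simp add: complex_eq_iff sin_arccos)

lemma Complex_sqrt_norm: "x \<in> {-1..1} \<Longrightarrow> norm (Complex x (sqrt (1 - x\<^sup>2))) = 1"
  using cis_arccos[of x] by (metis norm_cis)

section \<open>The Casoratian on the circle and the weight\<close>

context bqH_param
begin

text \<open>These are the products in \<open>casoratian\<close> at L = g u / 2, where L / L' = u^2.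
  The factor L - L' is left out because it vanishes at u = 1 and u = -1; the rest has no zeros on
  the circle.\<close>

definition wnum :: "complex \<Rightarrow> complex" where
  "wnum u = qpoch_inf q A * (qpoch_inf q (q * u\<^sup>2) * qpoch_inf q (q * (1 / u)\<^sup>2))"

lemma wnum_nonzero:
  assumes "norm u = 1"
  shows "wnum u \<noteq> 0"
proof -
  have "qpoch_inf q A \<noteq> 0" using qpoch_inf_eq_0_iff[OF q1] Aq by blast
  thus ?thesis using assms q1 unfolding wnum_def
    by (auto intro!: qpoch_inf_nonzero[OF q1] simp: norm_mult norm_power norm_divide)
qed

lemma wnum_lower_bound:
  obtains c where "c > 0" "\<And>u. norm u = 1 \<Longrightarrow> c \<le> norm (wnum u)"
proof -
  have "continuous_on (sphere 0 1) (\<lambda>u. norm (wnum u))"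
    unfolding wnum_def
    by (intro continuous_on_norm holomorphic_on_imp_continuous_on holomorphic_on_mult
          qpoch_inf_holomorphic[OF q1] holomorphic_intros) auto
  then obtain u0 where "u0 \<in> sphere 0 1" "\<And>u. u \<in> sphere 0 1 \<Longrightarrow> norm (wnum u0) \<le> norm (wnum u)"
    using continuous_attains_inf[of "sphere (0::complex) 1" "\<lambda>u. norm (wnum u)"] by fastforce
  thus ?thesis using wnum_nonzero[of u0] by (intro that[of "norm (wnum u0)"]) auto
qed

text \<open>For |v| = 1 both values belong to the same point of the cut, approached from its two
  sides. Over a common denominator the difference is the Casoratian.\<close>

lemma ratio_jump:
  assumes v: "v \<noteq> 0" and nz: "sl v \<noteq> 0" "sl (1 / v) \<noteq> 0"
  shows "ratio v - ratio (1 / v) = 2 / g * (v - 1 / v) * wnum v / (sl v * sl (1 / v))"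
proof -
  interpret bqH_split q A a "g / 2 * v" "g / 2 * (1 / v)" by (rule split[OF v])
  have q: "q * (g / 2 * v / (g / 2 * (1 / v))) = q * v\<^sup>2"
    "q * (g / 2 * (1 / v) / (g / 2 * v)) = q * (1 / v)\<^sup>2"
    using g0 v by (auto simp: field_simps power2_eq_square)
  have "g / 2 * (v * sr v * sl (1 / v) - 1 / v * sr (1 / v) * sl v) = g / 2 * ((v - 1 / v) * wnum v)"
    using casoratian unfolding q sl_def[symmetric] sr_def[symmetric] wnum_def
    by (simp add: algebra_simps)
  hence *: "v * sr v * sl (1 / v) - 1 / v * sr (1 / v) * sl v = (v - 1 / v) * wnum v"
    using g0 by simp
  have "ratio v - ratio (1 / v) = 2 / g * (v * sr v * sl (1 / v) - 1 / v * sr (1 / v) * sl v) / (sl v * sl (1 / v))"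
    unfolding ratio_def using nz by (simp add: diff_divide_distrib right_diff_distrib mult.assoc)
  thus ?thesis unfolding * by (simp only: mult.assoc)
qed

text \<open>At these finitely many points a vanishing product \<open>(L / a)\<^sub>\<infinity>\<close> makes the weight a junk value.\<close>

definition wexc :: "real set" where
  "wexc = {x \<in> {-1<..<1}. \<exists>k. g / 2 * Complex x (sqrt (1 - x\<^sup>2)) / a * q ^ k = 1
                        \<or> g / 2 * (1 / Complex x (sqrt (1 - x\<^sup>2))) / a * q ^ k = 1}"

lemma finite_wexc: "finite wexc"
proof -
  define F where "F = {v \<in> cball 0 1. \<exists>k. g / 2 * v / a * q ^ k = 1}"
  have "finite F" unfolding F_def by (rule finite_phi_poles)
  hence "finite (Re ` (F \<union> (\<lambda>v. 1 / v) ` F))" by simp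
  moreover have "wexc \<subseteq> Re ` (F \<union> (\<lambda>v. 1 / v) ` F)"
  proof
    fix x assume x: "x \<in> wexc"
    define u where "u = Complex x (sqrt (1 - x\<^sup>2))"
    have nu: "norm u = 1" unfolding u_def by (rule Complex_sqrt_norm) (use x in \<open>auto simp: wexc_def\<close>)
    have "\<exists>k. g / 2 * u / a * q ^ k = 1 \<or> g / 2 * (1 / u) / a * q ^ k = 1"
      using x unfolding wexc_def u_def by (simp only: mem_Collect_eq)
    moreover have "u \<in> cball 0 1" "1 / u \<in> cball 0 1" using nu by (simp_all add: norm_divide)
    ultimately have "u \<in> F \<or> 1 / u \<in> F" unfolding F_def by blast
    moreover have "u = 1 / (1 / u)" by simp
    ultimately have "u \<in> F \<union> (\<lambda>v. 1 / v) ` F" by blast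
    moreover have "x = Re u" by (simp add: u_def)
    ultimately show "x \<in> Re ` (F \<union> (\<lambda>v. 1 / v) ` F)" by blast
  qed
  ultimately show ?thesis by (rule finite_subset[rotated])
qed

text \<open>Splitting off the first factors of (u^2, u^(-2))_inf leaves \<open>wnum\<close> and (1 -
  u^2)(1 - u^(-2)) = -(u - 1/u)^2 = 4 (1 - x^2). The remaining products combine with the 2phi1
  factors to \<open>sl u\<close> and \<open>sl (1 / u)\<close>.\<close>

lemma weight_eq:
  assumes x: "x \<in> {-1<..<1}" "x \<notin> wexc"
  defines "u \<equiv> Complex x (sqrt (1 - x\<^sup>2))"
  shows "bqH_weight q A a g x = 2 * of_real (sqrt (1 - x\<^sup>2)) / of_real pi * (wnum u / (sl u * sl (1 / u)))"
proof -
  define s where "s = sqrt (1 - x\<^sup>2)"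
  have "x\<^sup>2 < 1" using x(1) by (auto simp: abs_square_less_1)
  hence s: "s > 0" by (simp add: s_def)
  have nu: "norm u = 1" unfolding u_def using x(1) by (intro Complex_sqrt_norm) auto
  hence u0: "u \<noteq> 0" by auto
  have "u * cnj u = 1" using complex_norm_square[of u] nu by simp
  hence cu: "1 / u = cnj u" using u0 by (metis nonzero_mult_div_cancel_left)
  have Lp: "g / 2 * (of_real x + \<i> * of_real (sqrt (1 - x\<^sup>2))) = g / 2 * u"
    and Lm: "g / 2 * (of_real x - \<i> * of_real (sqrt (1 - x\<^sup>2))) = g / 2 * (1 / u)"
    unfolding cu by (auto simp: u_def complex_eq_iff)
  have dif: "u - 1 / u = 2 * \<i> * of_real s"
    unfolding cu by (simp add: u_def s_def complex_eq_iff)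
  have np: "\<And>k. g / 2 * u / a * q ^ k \<noteq> 1" "\<And>k. g / 2 * (1 / u) / a * q ^ k \<noteq> 1"
  proof -
    have "\<nexists>k. g / 2 * u / a * q ^ k = 1 \<or> g / 2 * (1 / u) / a * q ^ k = 1"
      using x unfolding wexc_def u_def by (simp only: mem_Collect_eq simp_thms)
    thus "\<And>k. g / 2 * u / a * q ^ k \<noteq> 1" "\<And>k. g / 2 * (1 / u) / a * q ^ k \<noteq> 1" by blast+
  qed
  have arg: "g * u / (2 * a) = g / 2 * u / a" "g / (2 * a * u) = g / 2 * (1 / u) / a"
    by simp_all
  have sl: "sl u = qpoch_inf q (g / 2 * u / a) * phi21 q (A / q) (A * (g / 2 * u)) (g / 2 * u / a)"
    "sl (1 / u) = qpoch_inf q (g / 2 * (1 / u) / a) * phi21 q (A / q) (A * (g / 2 * (1 / u))) (g / 2 * (1 / u) / a)"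
    using sol_eq_phi21[OF np(1), of 0] sol_eq_phi21[OF np(2), of 0] unfolding sl_def by simp_all
  define w where "w = 1 / u"
  have uw: "u * w = 1" using u0 by (simp add: w_def)
  have w2: "1 / u\<^sup>2 = w\<^sup>2" by (simp add: w_def power_divide)
  have "qpoch_inf q (w\<^sup>2) * qpoch_inf q (u\<^sup>2) =
          ((1 - w\<^sup>2) * (1 - u\<^sup>2)) * (qpoch_inf q (q * u\<^sup>2) * qpoch_inf q (q * w\<^sup>2))"
    using qpoch_inf_Suc[OF q1, of "w\<^sup>2"] qpoch_inf_Suc[OF q1, of "u\<^sup>2"]
    by (simp only: mult_ac)
  also have "(1 - w\<^sup>2) * (1 - u\<^sup>2) = - (u - w)\<^sup>2" using uw by algebra
  also have "- (u - w)\<^sup>2 = 4 * (of_real s)\<^sup>2"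
    unfolding dif[folded w_def] by (simp add: power_mult_distrib)
  finally have num: "qpoch_inf q A * (qpoch_inf q (1 / u\<^sup>2) * qpoch_inf q (u\<^sup>2)) = 4 * (of_real s)\<^sup>2 * wnum u"
    unfolding wnum_def w_def[symmetric] w2 by (simp only: mult_ac)
  have "bqH_weight q A a g x = 1 / (2 * of_real pi * of_real s) * (4 * (of_real s)\<^sup>2 * wnum u / (sl u * sl (1 / u)))"
    unfolding bqH_weight_def Let_def
    unfolding u_def[symmetric] Lp Lm unfolding s_def[symmetric] num arg sl
    by (simp only: divide_inverse inverse_mult_distrib mult_ac)
  also have "\<dots> = 2 * of_real s / of_real pi * (wnum u / (sl u * sl (1 / u)))"
    using s by (simp add: power2_eq_square)
  finally show ?thesis by (simp add: s_def)
qed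

end

subsection \<open>Zeros of the denominator on the unit circle\<close>

context bqH_param
begin

text \<open>Upper bounds for the denominator of the weight near a zero or a multiple zero, from
  Taylor expansion of order 0 and 1 with a single constant.\<close>

lemma sl_Taylor_bounds:
  obtains C where "C > 0"
    "\<And>v. v \<in> cball 0 1 \<Longrightarrow> norm (sl v) \<le> C"
    "\<And>v w. v \<in> cball 0 1 \<Longrightarrow> w \<in> cball 0 1 \<Longrightarrow> sl w = 0 \<Longrightarrow> norm (sl v) \<le> C * norm (v - w)"
    "\<And>v w. v \<in> cball 0 1 \<Longrightarrow> w \<in> cball 0 1 \<Longrightarrow> sl w = 0 \<Longrightarrow> deriv sl w = 0 \<Longrightarrow>
       norm (sl v) \<le> C * norm (v - w) ^ 2"
proof -
  have sl: "sl holomorphic_on UNIV" using sl_holomorphic[of "\<lambda>x. x" UNIV] by (simp add: holomorphic_on_ident)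
  have d: "(deriv ^^ i) sl holomorphic_on UNIV" for i by (intro holomorphic_higher_deriv sl) auto
  have "\<exists>B. \<forall>v\<in>cball 0 1. norm ((deriv ^^ i) sl v) \<le> B" for i
  proof -
    have "bounded ((deriv ^^ i) sl ` cball 0 1)"
      by (intro compact_imp_bounded compact_continuous_image holomorphic_on_imp_continuous_on
            holomorphic_on_subset[OF d]) auto
    thus ?thesis by (auto simp: bounded_iff)
  qed
  then obtain B where B: "\<And>i v. v \<in> cball 0 1 \<Longrightarrow> norm ((deriv ^^ i) sl v) \<le> B i" by metis
  have der: "((deriv ^^ i) sl has_field_derivative (deriv ^^ Suc i) sl v) (at v within X)" for i v X
    using holomorphic_derivI[OF d, of v i] by (simp add: has_field_derivative_at_within)
  have T: "norm (sl v - (\<Sum>i\<le>n. (deriv ^^ i) sl w * (v - w) ^ i / fact i)) \<le> B (Suc n) * norm (v - w) ^ Suc n / fact n"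
    if "v \<in> cball 0 1" "w \<in> cball 0 1" for v w n
    using complex_Taylor[of "cball 0 1" n "\<lambda>i. (deriv ^^ i) sl" "B (Suc n)" w v, OF _ der B] that by simp
  define C where "C = max 1 (max (B 0) (max (B 1) (B 2)))"
  have C: "C > 0" "B 0 \<le> C" "B 1 \<le> C" "B 2 \<le> C" by (auto simp: C_def)
  show ?thesis
  proof (rule that[OF C(1)])
    fix v :: complex assume v: "v \<in> cball 0 1"
    show "norm (sl v) \<le> C" using B[OF v, of 0] C by simp
    fix w assume w: "w \<in> cball 0 1" "sl w = 0"
    have "norm (sl v) \<le> B 1 * norm (v - w)" using T[OF v w(1), of 0] w(2) by simp
    also have "\<dots> \<le> C * norm (v - w)" using C by (intro mult_right_mono) auto
    finally show "norm (sl v) \<le> C * norm (v - w)" .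
    assume "deriv sl w = 0"
    hence "norm (sl v) \<le> B 2 * norm (v - w) ^ 2"
      using T[OF v w(1), of 1] w(2) by (simp add: numeral_2_eq_2)
    also have "\<dots> \<le> C * norm (v - w) ^ 2" using C by (intro mult_right_mono) auto
    finally show "norm (sl v) \<le> C * norm (v - w) ^ 2" .
  qed
qed

definition circ :: "real \<Rightarrow> complex" where "circ x = Complex x (sqrt (1 - x\<^sup>2))"

lemma norm_circ: "x \<in> {-1..1} \<Longrightarrow> norm (circ x) = 1"
  unfolding circ_def by (rule Complex_sqrt_norm)

lemma inverse_circ: "x \<in> {-1..1} \<Longrightarrow> 1 / circ x = cnj (circ x)"
proof -
  assume x: "x \<in> {-1..1}"
  have "circ x * cnj (circ x) = 1" using complex_norm_square[of "circ x"] norm_circ[OF x] by simp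
  moreover have "circ x \<noteq> 0" using norm_circ[OF x] by auto
  ultimately show ?thesis by (metis nonzero_mult_div_cancel_left)
qed

lemma finite_circ_zeros: "finite {x \<in> {-1..1}. sl (circ x) = 0 \<or> sl (cnj (circ x)) = 0}"
proof -
  define Z where "Z = {v \<in> cball 0 1. sl v = 0}"
  have "finite (Re ` Z)" using finite_sl_zeros[of 1] by (simp add: Z_def)
  moreover have "{x \<in> {-1..1}. sl (circ x) = 0 \<or> sl (cnj (circ x)) = 0} \<subseteq> Re ` Z"
  proof
    fix x assume x: "x \<in> {x \<in> {-1..1}. sl (circ x) = 0 \<or> sl (cnj (circ x)) = 0}"
    hence "circ x \<in> Z \<or> cnj (circ x) \<in> Z" using norm_circ[of x] by (auto simp: Z_def)
    moreover have "Re (circ x) = x" "Re (cnj (circ x)) = x" by (simp_all add: circ_def)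
    ultimately show "x \<in> Re ` Z" by (metis image_eqI)
  qed
  ultimately show ?thesis by (rule finite_subset[rotated])
qed

text \<open>The square root in the bound cancels the one in the numerator of the weight, leaving c /
  (x - x1). The sign \<sigma> allows a reflection, so that the singularity can always be placed at
  the left end of the interval.\<close>

lemma weight_not_integrable:
  assumes int: "bqH_weight q A a g absolutely_integrable_on {-1..1}"
    and sub: "{x1..x1 + \<delta>} \<subseteq> {-1..1}" and \<delta>: "\<delta> > 0" and \<sigma>: "\<sigma> = 1 \<or> \<sigma> = -1" and C: "C > 0"
    and bound: "\<And>x. x \<in> {x1<..<x1 + \<delta>} \<Longrightarrow>
       norm (sl (circ (\<sigma> * x)) * sl (cnj (circ (\<sigma> * x)))) \<le> C * (sqrt (1 - x\<^sup>2) * (x - x1))"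
  shows False
proof -
  obtain c where c: "c > 0" "\<And>u. norm u = 1 \<Longrightarrow> c \<le> norm (wnum u)"
    using wnum_lower_bound by blast
  define h where "h x = norm (bqH_weight q A a g (\<sigma> * x))" for x
  \<comment> \<open>At zeros of the denominator the weight is 0 by the division convention and the
    lower bound fails; the right endpoint is added because \<open>bound\<close> covers the open
    interval only.\<close>
  define F where "F = (\<lambda>x. \<sigma> * x) ` (wexc \<union> {x \<in> {-1..1}. sl (circ x) = 0 \<or> sl (cnj (circ x)) = 0}) \<union> {x1 + \<delta>}"
  have F: "finite F" unfolding F_def using finite_wexc finite_circ_zeros by simp
  have \<sigma>\<sigma>: "\<sigma> * (\<sigma> * x) = x" for x using \<sigma> by auto
  have "(\<lambda>x. norm (bqH_weight q A a g x)) integrable_on {-1..1}"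
    using int by (simp add: absolutely_integrable_on_def)
  hence "h integrable_on {-1..1}"
    using \<sigma> Henstock_Kurzweil_Integration.integrable_reflect_real[where f = "\<lambda>x. norm (bqH_weight q A a g x)" and a = "-1" and b = 1]
    by (auto simp: h_def[abs_def])
  hence "h integrable_on {x1..x1 + \<delta>}" using sub by (rule integrable_on_subinterval)
  moreover have "c / C * (2 / pi) / (x - x1) \<le> h x" if x: "x \<in> {x1<..x1 + \<delta>} - F" for x
  proof -
    have x1: "x \<in> {x1<..<x1 + \<delta>}" using x by (auto simp: F_def)
    have "x1 \<ge> -1" "x1 + \<delta> \<le> 1" using sub \<delta> by auto
    hence x2: "x \<in> {-1<..<1}" using x1 by auto
    hence x3: "\<sigma> * x \<in> {-1<..<1}" using \<sigma> by auto
    have nF: "\<sigma> * x \<notin> wexc" "\<not> (sl (circ (\<sigma> * x)) = 0 \<or> sl (cnj (circ (\<sigma> * x))) = 0)"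
    proof -
      have *: "\<sigma> * x \<notin> wexc \<union> {x \<in> {-1..1}. sl (circ x) = 0 \<or> sl (cnj (circ x)) = 0}"
      proof
        assume "\<sigma> * x \<in> wexc \<union> {x \<in> {-1..1}. sl (circ x) = 0 \<or> sl (cnj (circ x)) = 0}"
        hence "\<sigma> * (\<sigma> * x) \<in> F" unfolding F_def by blast
        thus False using x \<sigma>\<sigma> by simp
      qed
      thus "\<sigma> * x \<notin> wexc" by blast
      show "\<not> (sl (circ (\<sigma> * x)) = 0 \<or> sl (cnj (circ (\<sigma> * x))) = 0)"
        using * x3 by auto
    qed
    define s where "s = sqrt (1 - x\<^sup>2)"
    have sq: "(\<sigma> * x)\<^sup>2 = x\<^sup>2" using \<sigma> by (auto simp: power_mult_distrib)
    have "x\<^sup>2 < 1" using x2 by (auto simp: abs_square_less_1)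
    hence s: "s > 0" by (simp add: s_def)
    define M where "M = norm (sl (circ (\<sigma> * x)) * sl (cnj (circ (\<sigma> * x))))"
    have M: "M > 0" "M \<le> C * (s * (x - x1))" using nF(2) bound[OF x1] by (auto simp: M_def s_def)
    have "bqH_weight q A a g (\<sigma> * x) = 2 * of_real s / of_real pi *
            (wnum (circ (\<sigma> * x)) / (sl (circ (\<sigma> * x)) * sl (cnj (circ (\<sigma> * x)))))"
      using weight_eq[OF x3 nF(1), folded circ_def] inverse_circ[of "\<sigma> * x"] x3 unfolding s_def sq by simp
    hence "h x = 2 * s / pi * (norm (wnum (circ (\<sigma> * x))) / M)"
      unfolding h_def M_def using s by (simp add: norm_mult norm_divide)
    also have "\<dots> \<ge> 2 * s / pi * (c / (C * (s * (x - x1))))"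
      using c M s norm_circ[of "\<sigma> * x"] x3
      by (intro mult_left_mono frac_le c(2)) (auto intro!: divide_nonneg_nonneg)
    also have "2 * s / pi * (c / (C * (s * (x - x1)))) = c / C * (2 / pi) / (x - x1)"
      using s by (simp add: mult_ac)
    finally show ?thesis .
  qed
  ultimately show False
    by (intro not_integrable_pole[of h x1 \<delta> "c / C * (2 / pi)" F] \<delta> F) (use c C in \<open>auto simp: h_def\<close>)
qed

text \<open>At an interior point the square root stays away from 0, one factor of the denominator
  vanishes at least linearly and the other is bounded: already a simple zero is too much.\<close>

lemma circle_zeros:
  assumes int: "bqH_weight q A a g absolutely_integrable_on {-1..1}"
    and v1: "norm v1 = 1" "sl v1 = 0"
  shows "v1 = 1 \<or> v1 = -1"
proof (rule ccontr)
  assume ne: "\<not> (v1 = 1 \<or> v1 = -1)"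
  obtain C where C: "C > 0" "\<And>v. v \<in> cball 0 1 \<Longrightarrow> norm (sl v) \<le> C"
    "\<And>v w. v \<in> cball 0 1 \<Longrightarrow> w \<in> cball 0 1 \<Longrightarrow> sl w = 0 \<Longrightarrow> norm (sl v) \<le> C * norm (v - w)"
    using sl_Taylor_bounds by metis
  define x1 where "x1 = Re v1"
  have sum1: "(Re v1)\<^sup>2 + (Im v1)\<^sup>2 = 1" using v1(1) by (metis cmod_power2 one_power2)
  have "Im v1 \<noteq> 0"
  proof
    assume "Im v1 = 0"
    hence "(Re v1)\<^sup>2 = 1" using sum1 by simp
    hence "Re v1 = 1 \<or> Re v1 = -1" by (simp add: power2_eq_1_iff)
    thus False using ne \<open>Im v1 = 0\<close> by (auto simp: complex_eq_iff)
  qed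
  hence x1sq: "x1\<^sup>2 < 1" using sum1 unfolding x1_def by (smt (verit) zero_less_power2)
  hence x1: "-1 < x1" "x1 < 1" by (auto simp: abs_square_less_1 abs_less_iff)
  define s1 where "s1 = sqrt (1 - x1\<^sup>2)"
  have s1: "s1 > 0" using x1sq by (simp add: s1_def)
  have v1c: "v1 = circ x1 \<or> v1 = cnj (circ x1)"
  proof -
    have "(Im v1)\<^sup>2 = 1 - x1\<^sup>2" using sum1 by (simp add: x1_def)
    hence "\<bar>Im v1\<bar> = s1" by (simp add: s1_def flip: real_sqrt_abs)
    thus ?thesis by (auto simp: circ_def complex_eq_iff x1_def s1_def abs_if split: if_splits)
  qed
  \<comment> \<open>The interval ends halfway to 1, so 1 - x >= \<delta> and 1 + x >= 1 + x1 on it;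
    this makes \<open>m\<close> a lower bound for sqrt(1 - x^2).\<close>
  define \<delta> where "\<delta> = (1 - x1) / 2"
  have \<delta>: "\<delta> > 0" using x1 by (simp add: \<delta>_def)
  define m where "m = sqrt (\<delta> * (1 + x1))"
  have m: "m > 0" using \<delta> x1 by (simp add: m_def)
  \<comment> \<open>A Lipschitz constant of \<open>circ\<close> from x1 to the right: |x + x1| <= 2
    and s + s1 >= s1 give |s - s1| <= 2 / s1 * (x - x1).\<close>
  define K where "K = 1 + 2 / s1"
  have K: "K > 0" using s1 by (simp add: K_def add_pos_pos)
  show False
  proof (rule weight_not_integrable[OF int _ \<delta>, of x1 1 "C * K * C / m"])
    show "{x1..x1 + \<delta>} \<subseteq> {- 1..1}" using x1 by (auto simp: \<delta>_def field_simps)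
    show "C * K * C / m > 0" using C K m by simp
    fix x assume x: "x \<in> {x1<..<x1 + \<delta>}"
    have x2: "x < 1" "x > -1" "1 - x \<ge> \<delta>" using x x1 by (auto simp: \<delta>_def field_simps)
    define s where "s = sqrt (1 - x\<^sup>2)"
    have "\<delta> * (1 + x1) \<le> (1 - x) * (1 + x)"
      using x x2 \<delta> x1 by (intro mult_mono) auto
    also have "\<dots> = 1 - x\<^sup>2" by (simp add: algebra_simps power2_eq_square)
    finally have ms: "m \<le> s" by (simp add: m_def s_def)
    have "x\<^sup>2 < 1" using x2 by (auto simp: abs_square_less_1)
    hence ssq: "s\<^sup>2 - s1\<^sup>2 = - ((x - x1) * (x + x1))"
      using x1sq by (simp add: s_def s1_def algebra_simps power2_eq_square)
    have ds: "\<bar>s - s1\<bar> \<le> 2 / s1 * (x - x1)"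
    proof -
      have "\<bar>s - s1\<bar> * s1 \<le> \<bar>s - s1\<bar> * (s + s1)" using m ms by (intro mult_left_mono) auto
      also have "\<dots> = \<bar>s\<^sup>2 - s1\<^sup>2\<bar>"
      proof -
        have "s\<^sup>2 - s1\<^sup>2 = (s - s1) * (s + s1)" by (simp add: power2_eq_square algebra_simps)
        thus ?thesis using m ms s1 by (simp add: abs_mult)
      qed
      also have "\<dots> = (x - x1) * \<bar>x + x1\<bar>" unfolding ssq using x by (simp add: abs_mult)
      also have "\<dots> \<le> (x - x1) * 2" using x x1 x2 by (intro mult_left_mono) auto
      finally show ?thesis using s1 by (simp add: field_simps)
    qed
    have close: "norm (circ x - circ x1) \<le> K * (x - x1)"
    proof -
      have "norm (circ x - circ x1) \<le> \<bar>x - x1\<bar> + \<bar>s - s1\<bar>"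
        using cmod_le[of "circ x - circ x1"] by (simp add: circ_def s_def s1_def)
      also have "\<dots> \<le> (x - x1) + 2 / s1 * (x - x1)" using ds x by simp
      finally show ?thesis by (simp add: K_def algebra_simps)
    qed
    have cjc: "norm (cnj (circ x) - cnj (circ x1)) = norm (circ x - circ x1)"
      by (metis complex_cnj_diff complex_mod_cnj)
    have mem: "circ x \<in> cball 0 1" "cnj (circ x) \<in> cball 0 1" "circ x1 \<in> cball 0 1" "cnj (circ x1) \<in> cball 0 1"
      using norm_circ[of x] norm_circ[of x1] x1 x2 by auto
    have "norm (sl (circ x)) * norm (sl (cnj (circ x))) \<le> C * K * (x - x1) * C"
      using v1c
    proof
      assume v: "v1 = circ x1"
      have "norm (sl (circ x)) \<le> C * (K * (x - x1))"
        using C(3)[OF mem(1,3)] v1(2) close C(1) unfolding v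
        by (meson mult_left_mono order_less_imp_le order_trans)
      thus ?thesis using C(2)[OF mem(2)] C(1) K x
        by (intro mult_mono) (auto simp: mult.assoc)
    next
      assume v: "v1 = cnj (circ x1)"
      have "norm (sl (cnj (circ x))) \<le> C * (K * (x - x1))"
        using C(3)[OF mem(2,4)] v1(2) close C(1) unfolding v cjc
        by (meson mult_left_mono order_less_imp_le order_trans)
      hence "norm (sl (cnj (circ x))) * norm (sl (circ x)) \<le> C * (K * (x - x1)) * C"
        using C(2)[OF mem(1)] C(1) K x by (intro mult_mono) auto
      thus ?thesis by (simp add: mult_ac)
    qed
    also have "\<dots> = C * K * C / m * (m * (x - x1))" using m by simp
    also have "\<dots> \<le> C * K * C / m * (s * (x - x1))"
      using C K m ms x by (intro mult_left_mono mult_right_mono) auto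
    finally show "norm (sl (circ (1 * x)) * sl (cnj (circ (1 * x)))) \<le> C * K * C / m * (sqrt (1 - x\<^sup>2) * (x - x1))"
      by (simp add: norm_mult s_def)
  qed simp
qed

text \<open>Near an endpoint both \<open>circ y\<close> and its conjugate approach \<tau>, with
  squared distance 2 (1 - \<tau> y). A multiple zero thus makes the product of the two factors O((1
  - \<tau> y)^2).\<close>

lemma circle_zero_simple:
  assumes int: "bqH_weight q A a g absolutely_integrable_on {-1..1}"
    and \<tau>: "\<tau> = 1 \<or> \<tau> = -1" and z: "sl (of_real \<tau>) = 0"
  shows "deriv sl (of_real \<tau>) \<noteq> 0"
proof
  assume d: "deriv sl (of_real \<tau>) = 0"
  obtain C where C: "C > 0"
    "\<And>v w. v \<in> cball 0 1 \<Longrightarrow> w \<in> cball 0 1 \<Longrightarrow> sl w = 0 \<Longrightarrow> deriv sl w = 0 \<Longrightarrow>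
       norm (sl v) \<le> C * norm (v - w) ^ 2"
    using sl_Taylor_bounds by metis
  have \<tau>1: "complex_of_real \<tau> \<in> cball 0 1" using \<tau> by auto
  show False
  \<comment> \<open>The reflection moves \<tau> to the left end -1; length 1 keeps x < 0, where x +
    1 <= sqrt(1 - x^2). The constant is (2 C)^2.\<close>
  proof (rule weight_not_integrable[OF int, of "-1" 1 "-\<tau>" "4 * C * C"])
    fix x :: real assume x: "x \<in> {-1<..<-1 + 1}"
    define y where "y = - \<tau> * x"
    have y: "y \<in> {-1..1}" "y\<^sup>2 = x\<^sup>2" "\<tau> * y = - x" using x \<tau> by (auto simp: y_def)
    have dist: "norm (circ y - of_real \<tau>) ^ 2 = 2 * (x + 1)"
    proof -
      have "norm (circ y - of_real \<tau>) ^ 2 = (y - \<tau>)\<^sup>2 + (sqrt (1 - y\<^sup>2))\<^sup>2"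
        by (simp add: cmod_power2 circ_def)
      also have "(sqrt (1 - y\<^sup>2))\<^sup>2 = 1 - y\<^sup>2"
        using y(1) by (auto simp: abs_square_le_1)
      also have "(y - \<tau>)\<^sup>2 + (1 - y\<^sup>2) = 1 + \<tau>\<^sup>2 - 2 * (\<tau> * y)"
        by (simp add: power2_eq_square algebra_simps)
      also have "\<dots> = 2 * (x + 1)" using \<tau> y(3) by auto
      finally show ?thesis .
    qed
    have "norm (cnj (circ y) - of_real \<tau>) = norm (circ y - of_real \<tau>)"
      by (metis complex_cnj_complex_of_real complex_cnj_diff complex_mod_cnj)
    hence dist': "norm (cnj (circ y) - of_real \<tau>) ^ 2 = 2 * (x + 1)" using dist by simp
    have mem: "circ y \<in> cball 0 1" "cnj (circ y) \<in> cball 0 1" using norm_circ[OF y(1)] by auto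
    have "norm (sl (circ y)) * norm (sl (cnj (circ y))) \<le> (C * (2 * (x + 1))) * (C * (2 * (x + 1)))"
      using C(2)[OF mem(1) \<tau>1 z d] C(2)[OF mem(2) \<tau>1 z d] C(1) x unfolding dist dist'
      by (intro mult_mono) auto
    also have "\<dots> = 4 * C * C * ((x + 1) * (x + 1))" by (simp add: algebra_simps)
    also have "\<dots> \<le> 4 * C * C * (sqrt (1 - x\<^sup>2) * (x + 1))"
    proof -
      have "(x + 1)\<^sup>2 \<le> (x + 1) * (1 - x)"
        unfolding power2_eq_square using x by (intro mult_left_mono) auto
      also have "\<dots> = 1 - x\<^sup>2" by (simp add: algebra_simps power2_eq_square)
      finally have "x + 1 \<le> sqrt (1 - x\<^sup>2)" by (rule real_le_rsqrt)
      thus ?thesis using C x by (intro mult_left_mono mult_right_mono) auto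
    qed
    finally show "norm (sl (circ (- \<tau> * x)) * sl (cnj (circ (- \<tau> * x)))) \<le> 4 * C * C * (sqrt (1 - x\<^sup>2) * (x - - 1))"
      by (simp add: norm_mult y_def)
  qed (use \<tau> C in auto)
qed

end

subsection \<open>The integral representation\<close>

lemma deriv_jouk: "v \<noteq> 0 \<Longrightarrow> deriv (jouk g) v = g / 2 * (1 - 1 / v\<^sup>2)"
  unfolding jouk_def[abs_def]
  by (rule DERIV_imp_deriv) (auto intro!: derivative_eq_intros simp: power2_eq_square field_simps)

lemma unit_disc_power2_neq_1: "norm v < 1 \<Longrightarrow> v\<^sup>2 \<noteq> (1 :: complex)"
  by (metis less_irrefl norm_one power2_eq_1_iff norm_minus_cancel)

lemma unit_disc_mult_neq_1:
  assumes "norm v \<le> 1" "norm w < 1" shows "v * w \<noteq> (1 :: complex)"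
proof
  assume "v * w = 1"
  hence "norm v * norm w = 1" by (metis norm_mult norm_one)
  moreover have "norm v * norm w \<le> 1 * norm w" using assms by (intro mult_right_mono) auto
  ultimately show False using assms by simp
qed

section \<open>The Cauchy kernel in the variable \<open>v\<close>\<close>

context bqH_param
begin

lemma sl_UNIV: "sl holomorphic_on UNIV" and sr_UNIV: "sr holomorphic_on UNIV"
  using sl_holomorphic[of "\<lambda>x. x" UNIV] sr_holomorphic[of "\<lambda>x. x" UNIV] by (simp_all add: holomorphic_on_ident)

text \<open>With all powers of v cancelled the kernel is regular at v = 0, so the point at infinity
  contributes nothing to the residue theorem. The factor v^2 - 1 comes from dz / dv.\<close>

definition kern :: "complex \<Rightarrow> complex \<Rightarrow> complex" where
  "kern v0 v = 2 / g * v0 * sr v * (v\<^sup>2 - 1) / (sl v * ((v0 - v) * (v * v0 - 1)))"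

text \<open>\<open>kern v0\<close> is the Cauchy kernel \<open>F \<zeta> / (z0 - \<zeta>) d\<zeta>\<close> pulled back along \<open>\<zeta> = jouk g v\<close>.\<close>

lemma kern_eq:
  assumes "v \<noteq> 0" "v0 \<noteq> 0" "v \<noteq> v0" "v * v0 \<noteq> 1"
  shows "deriv (jouk g) v * (ratio v / (jouk g v0 - jouk g v)) = kern v0 v"
proof -
  have 1: "deriv (jouk g) v = g / 2 * ((v\<^sup>2 - 1) / v\<^sup>2)"
    using assms(1) by (simp add: deriv_jouk diff_divide_distrib)
  have 2: "jouk g v0 - jouk g v = g / 2 * ((v0 - v) * (v * v0 - 1) / (v * v0))"
    using assms(1,2) unfolding jouk_def by (simp add: field_simps)
  have "X / 2 * (N / v\<^sup>2) * (2 / X * v * r / s / (X / 2 * (M / (v * v0)))) = 2 / X * v0 * r * N / (s * M)"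
    if "X \<noteq> 0" for X N r s M :: complex
    using that assms(1,2) by (simp add: power2_eq_square mult_ac)
  from this[OF g0] show ?thesis unfolding 1 2 ratio_def kern_def .
qed

lemma kern_meromorphic: "kern v0 meromorphic_on UNIV"
  unfolding kern_def[abs_def]
  by (intro meromorphic_on_divide meromorphic_on_mult meromorphic_on_diff meromorphic_on_power
        meromorphic_on_const meromorphic_on_id analytic_on_imp_meromorphic_on)
     (use sl_UNIV sr_UNIV in \<open>auto simp: analytic_on_open\<close>)

lemma kern_isolated: "isolated_singularity_at (kern v0) v"
  by (rule meromorphic_on_isolated_singularity[OF meromorphic_on_subset[OF kern_meromorphic]]) auto

lemma kern_analytic:
  assumes "sl v \<noteq> 0" "v \<noteq> v0" "v * v0 \<noteq> 1"
  shows "kern v0 analytic_on {v}"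
proof -
  have "sl analytic_on {v}" "sr analytic_on {v}"
    using sl_UNIV sr_UNIV by (auto simp: analytic_on_open intro: analytic_on_subset[of _ UNIV])
  thus ?thesis unfolding kern_def[abs_def] using assms
    by (intro analytic_on_divide analytic_on_mult analytic_on_diff analytic_on_power
          analytic_on_const analytic_on_ident) auto
qed

lemma kern_residue_centre:
  assumes v0: "v0 \<in> ball 0 1 - {0}" "sl v0 \<noteq> 0"
  shows "residue (kern v0) v0 = - ratio v0"
proof -
  define f where "f w = - (2 / g * v0 * sr w * (w\<^sup>2 - 1) / (sl w * (w * v0 - 1)))" for w
  define s where "s = {w. sl w * (w * v0 - 1) \<noteq> 0}"
  have neg: "X / (S * ((v0 - w) * M)) = - (X / (S * M)) / (w - v0)" for X S M w :: complex
  proof -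
    have "S * ((v0 - w) * M) = - ((S * M) * (w - v0))" by (simp add: algebra_simps)
    thus ?thesis by simp
  qed
  have kf: "kern v0 = (\<lambda>w. f w / (w - v0))"
    by (rule ext) (simp only: kern_def f_def neg)
  have sq: "v0\<^sup>2 - 1 \<noteq> 0" using unit_disc_power2_neq_1[of v0] v0 by simp
  have "residue (kern v0) v0 = f v0"
    unfolding kf
  proof (rule residue_simple)
    have "continuous_on UNIV (\<lambda>w. sl w * (w * v0 - 1))"
      using sl_UNIV by (intro holomorphic_on_imp_continuous_on holomorphic_intros)
    hence "open ((\<lambda>w. sl w * (w * v0 - 1)) -` (- {0}))"
      by (intro open_vimage) auto
    thus "open s" by (simp add: s_def vimage_def)
    show "v0 \<in> s" using v0 sq by (simp add: s_def power2_eq_square)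
    show "f holomorphic_on s" unfolding f_def[abs_def]
      by (intro holomorphic_on_minus holomorphic_on_divide holomorphic_on_mult holomorphic_on_diff
            holomorphic_on_power holomorphic_on_const holomorphic_on_ident
            holomorphic_on_subset[OF sl_UNIV] holomorphic_on_subset[OF sr_UNIV]) (auto simp: s_def)
  qed
  also have "f v0 = - ratio v0"
    using sq by (simp add: f_def ratio_def power2_eq_square)
  finally show ?thesis .
qed

lemma kern_residue_pole:
  assumes v0: "v0 \<in> ball 0 1 - {0}" "sl v0 \<noteq> 0" and p: "p \<in> ball 0 1" "sl p = 0"
  shows "residue (kern v0) p = residue (\<lambda>\<zeta>. bqH_ratio q A a g \<zeta> / (jouk g v0 - \<zeta>)) (jouk g p)"
proof -
  have p0: "p \<noteq> 0" and pv: "p \<noteq> v0" using p v0 sl_0 by auto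
  have p': "p \<in> ball 0 1 - {0}" using p p0 by simp
  define P where "P = jouk g p"
  have P: "P \<in> cut_domain g" unfolding P_def jouk_image[OF g0, symmetric] using p' by (rule imageI)
  define G where "G \<zeta> = ratio (jouk_inv g \<zeta>) / (jouk g v0 - \<zeta>)" for \<zeta>
  \<comment> \<open>\<open>v0\<close> is included because \<open>G\<close> is also singular at
    \<open>jouk g v0\<close>.\<close>
  define F where "F = insert v0 {v \<in> cball 0 1. sl v = 0}"
  have "finite (F \<inter> ball 0 1)" unfolding F_def using finite_sl_zeros[of 1] by simp
  from eventually_jouk_inv_notin[OF g0 P this]
  obtain \<rho> where \<rho>: "\<rho> > 0" "\<And>w. w \<noteq> P \<Longrightarrow> dist w P < \<rho> \<Longrightarrow> w \<in> cut_domain g \<and> jouk_inv g w \<notin> F"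
    unfolding eventually_at by auto
  have inside: "w \<in> cut_domain g" "sl (jouk_inv g w) \<noteq> 0" "jouk g v0 - w \<noteq> 0" if "w \<in> ball P \<rho> - {P}" for w
  proof -
    have w: "w \<in> cut_domain g" "jouk_inv g w \<notin> F" using \<rho>(2)[of w] that by (auto simp: dist_commute)
    show "w \<in> cut_domain g" by fact
    show "sl (jouk_inv g w) \<noteq> 0" using w(2) jouk_inv_mem(1)[OF g0 w(1)] by (auto simp: F_def)
    show "jouk g v0 - w \<noteq> 0"
    proof
      assume "jouk g v0 - w = 0"
      hence "jouk_inv g w = v0" using jouk_inv_jouk[OF g0 v0(1)] by simp
      thus False using w(2) by (simp add: F_def)
    qed
  qed
  have G: "G holomorphic_on ball P \<rho> - {P}"
  proof -
    have J: "jouk_inv g holomorphic_on ball P \<rho> - {P}"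
      using jouk_inv_holomorphic[OF g0] inside(1) by (blast intro: holomorphic_on_subset)
    show ?thesis unfolding G_def[abs_def] ratio_def
      by (intro holomorphic_on_divide holomorphic_on_mult holomorphic_on_diff
            holomorphic_on_const holomorphic_on_ident sl_holomorphic sr_holomorphic J)
         (use inside(2,3) g0 in auto)
  qed
  have d: "deriv (jouk g) p \<noteq> 0"
    using unit_disc_power2_neq_1[of p] p g0 p0 by (simp add: deriv_jouk)
  have "residue (kern v0) p = residue (\<lambda>v. deriv (jouk g) v * G (jouk g v)) p"
  proof (rule residue_cong)
    have "eventually (\<lambda>v. v \<in> ball 0 1 - {0} - {v0}) (at p)"
      by (intro eventually_at_in_open') (use p' pv in auto)
    thus "eventually (\<lambda>v. kern v0 v = deriv (jouk g) v * G (jouk g v)) (at p)"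
    proof eventually_elim
      case (elim v)
      hence v: "v \<in> ball 0 1 - {0}" "v \<noteq> v0" by auto
      have "v * v0 \<noteq> 1" using v v0 by (intro unit_disc_mult_neq_1) auto
      from kern_eq[OF _ _ v(2) this] v v0 show ?case
        by (simp add: G_def jouk_inv_jouk[OF g0 v(1)])
    qed
  qed simp
  also have "\<dots> = residue G (jouk g p)"
    by (rule residue_conformal[where S = "ball 0 1 - {0}" and \<rho> = \<rho>])
       (use G \<rho> p' d in \<open>auto simp: P_def intro!: jouk_holomorphic open_delete\<close>)
  also have "\<dots> = residue (\<lambda>\<zeta>. bqH_ratio q A a g \<zeta> / (jouk g v0 - \<zeta>)) (jouk g p)"
  proof (rule residue_cong)
    show "eventually (\<lambda>\<zeta>. G \<zeta> = bqH_ratio q A a g \<zeta> / (jouk g v0 - \<zeta>)) (at (jouk g p))"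
      using eventually_bqH_ratio_eq[OF P] unfolding P_def
      by eventually_elim (auto simp: G_def)
  qed simp
  finally show ?thesis .
qed

lemma sum_residues:
  assumes v0: "v0 \<in> ball 0 1 - {0}" "sl v0 \<noteq> 0"
  shows "(\<Sum>p\<in>{v \<in> ball 0 1. sl v = 0}. residue (kern v0) p) = bqH_pole_terms q A a g (jouk g v0)"
proof -
  have "{v \<in> ball 0 1. sl v = 0} \<subseteq> ball 0 1 - {0}" using sl_0 by auto
  hence inj: "inj_on (jouk g) {v \<in> ball 0 1. sl v = 0}"
    using inj_on_jouk[OF g0] by (rule inj_on_subset[rotated])
  show ?thesis
    unfolding bqH_pole_terms_def bqH_poles_eq sum.reindex[OF inj] o_def
    by (intro sum.cong refl kern_residue_pole v0) auto
qed

context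
  fixes v0 :: complex
  assumes int: "bqH_weight q A a g absolutely_integrable_on {-1..1}"
    and v0: "v0 \<in> ball 0 1 - {0}" "sl v0 \<noteq> 0"
begin

text \<open>A simple zero of \<open>sl\<close> at 1 or -1 is cancelled by v^2 - 1; filling in the
  limits leaves the unit circle free of singularities.\<close>

definition kt :: "complex \<Rightarrow> complex" where "kt = remove_sings (kern v0)"

lemma kt_analytic_circle:
  assumes v: "norm v = 1"
  shows "kt analytic_on {v}"
proof (cases "sl v = 0")
  case False
  have "v * v0 \<noteq> 1" using v v0 by (intro unit_disc_mult_neq_1) auto
  moreover have "v \<noteq> v0" using v v0 by auto
  ultimately show ?thesis unfolding kt_def using False
    by (intro remove_sings_analytic_on kern_analytic)
next
  case True
  from circle_zeros[OF int v True] obtain \<tau> :: real where \<tau>: "\<tau> = 1 \<or> \<tau> = -1" "v = of_real \<tau>"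
    by (metis of_real_1 of_real_minus)
  have d: "deriv sl v \<noteq> 0" using circle_zero_simple[OF int \<tau>(1)] True \<tau>(2) by simp
  have sq: "v\<^sup>2 = 1" using \<tau> by auto
  have "(sl has_field_derivative deriv sl v) (at v)"
    using sl_UNIV by (intro holomorphic_derivI[of _ UNIV]) auto
  hence l1: "((\<lambda>w. sl w / (w - v)) \<longlongrightarrow> deriv sl v) (at v)"
    using True by (simp add: has_field_derivative_iff)
  have "((\<lambda>w. w\<^sup>2) has_field_derivative 2 * v) (at v)"
    by (auto intro!: derivative_eq_intros)
  hence l2: "((\<lambda>w. (w\<^sup>2 - 1) / (w - v)) \<longlongrightarrow> 2 * v) (at v)"
    using sq by (simp add: has_field_derivative_iff)
  have ne: "(v0 - v) * (v * v0 - 1) \<noteq> 0"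
    using unit_disc_mult_neq_1[of v v0] v v0 by auto
  have "isCont sr v" by (rule isCont_sr)
  hence l3: "(sr \<longlongrightarrow> sr v) (at v)" by (simp add: isCont_def)
  \<comment> \<open>Numerator and denominator are divided by w - v; the new denominator tends to a
    nonzero value exactly because the zero of \<open>sl\<close> is simple.\<close>
  have "((\<lambda>w. 2 / g * v0 * sr w * ((w\<^sup>2 - 1) / (w - v)) / (sl w / (w - v) * ((v0 - w) * (w * v0 - 1)))) \<longlongrightarrow>
          2 / g * v0 * sr v * (2 * v) / (deriv sl v * ((v0 - v) * (v * v0 - 1)))) (at v)"
    by (intro tendsto_intros l1 l2 l3 g0) (use d ne in auto)
  also have "?this \<longleftrightarrow> (kern v0 \<longlongrightarrow> 2 / g * v0 * sr v * (2 * v) / (deriv sl v * ((v0 - v) * (v * v0 - 1)))) (at v)"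
  proof (intro filterlim_cong refl)
    have "eventually (\<lambda>w. w \<noteq> v) (at v)" by (rule eventually_neq_at_within)
    thus "eventually (\<lambda>w. 2 / g * v0 * sr w * ((w\<^sup>2 - 1) / (w - v)) / (sl w / (w - v) * ((v0 - w) * (w * v0 - 1)))
            = kern v0 w) (at v)"
    proof eventually_elim
      case (elim w)
      have "X * (Y / D) / (S / D * M) = X * Y / (S * M)" if "D \<noteq> 0" for X Y D S M :: complex
        using that by simp
      from this[of "w - v"] elim show ?case by (simp add: kern_def)
    qed
  qed
  finally show ?thesis unfolding kt_def by (rule remove_sings_analytic_at[OF kern_isolated])
qed

lemma kt_contour_integral:
  "contour_integral (circlepath 0 1) kt =
     2 * pi * \<i> * (bqH_pole_terms q A a g (jouk g v0) - ratio v0)"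
proof -
  define Z where "Z = {v \<in> ball 0 1. sl v = 0}"
  \<comment> \<open>The residue theorem needs an open disc around the closed one without further
    poles. Its radius stays below the zeros of \<open>sl\<close> outside the circle and the pole v =
    1 / v0; the cap 2 ensures that only finitely many zeros compete.\<close>
  define W where "W = norm ` {v \<in> cball 0 2. sl v = 0} \<inter> {1<..}"
  define R where "R = Min (insert 2 (insert (1 / norm v0) W))"
  have fW: "finite W" unfolding W_def using finite_sl_zeros[of 2] by blast
  have nv0: "norm v0 < 1" "norm v0 > 0" using v0 by auto
  have R1: "R > 1" unfolding R_def using fW nv0 by (subst Min_gr_iff) (auto simp: W_def)
  have R2: "R \<le> 2" "R \<le> 1 / norm v0" "\<And>r. r \<in> W \<Longrightarrow> R \<le> r"
    unfolding R_def using fW by (intro Min_le; simp)+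
  have fZ: "finite Z" unfolding Z_def by (rule finite_subset[OF _ finite_sl_zeros[of 1]]) auto
  have "kt analytic_on {v}" if v: "v \<in> ball 0 R - insert v0 Z" for v
  proof -
    consider "norm v < 1" | "norm v = 1" | "norm v > 1" by linarith
    thus ?thesis
    proof cases
      case 1
      hence "v * v0 \<noteq> 1" using nv0 by (intro unit_disc_mult_neq_1) auto
      moreover have "sl v \<noteq> 0" using v 1 by (auto simp: Z_def)
      ultimately show ?thesis unfolding kt_def using v by (intro remove_sings_analytic_on kern_analytic) auto
    next
      case 2
      thus ?thesis by (rule kt_analytic_circle)
    next
      case 3
      have vR: "norm v < R" using v by simp
      have "sl v \<noteq> 0"
      proof
        assume "sl v = 0"
        hence "norm v \<in> W" using 3 vR R2(1) by (auto simp: W_def)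
        from R2(3)[OF this] vR show False by simp
      qed
      moreover have "v * v0 \<noteq> 1"
      proof
        assume "v * v0 = 1"
        hence "norm v * norm v0 = 1" by (metis norm_mult norm_one)
        hence "norm v = 1 / norm v0" using nv0 by (simp add: field_simps)
        with vR R2(2) show False by simp
      qed
      ultimately show ?thesis unfolding kt_def using v by (intro remove_sings_analytic_on kern_analytic) auto
    qed
  qed
  hence holo: "kt holomorphic_on ball 0 R - insert v0 Z"
    by (intro analytic_imp_holomorphic) (subst analytic_on_analytic_at, blast)
  have "contour_integral (circlepath 0 1) kt =
          2 * pi * \<i> * (\<Sum>p\<in>insert v0 Z. winding_number (circlepath 0 1) p * residue kt p)"
  proof (rule Residue_theorem[where S = "ball 0 R"])
    show "path_image (circlepath 0 1) \<subseteq> ball 0 R - insert v0 Z"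
      using R1 nv0 by (auto simp: Z_def)
    show "\<forall>z. z \<notin> ball 0 R \<longrightarrow> winding_number (circlepath 0 1) z = 0"
      using R1 by (auto intro!: winding_number_zero_outside[of _ "ball 0 R"])
  qed (use holo fZ in auto)
  also have "(\<Sum>p\<in>insert v0 Z. winding_number (circlepath 0 1) p * residue kt p) =
             (\<Sum>p\<in>insert v0 Z. residue (kern v0) p)"
  proof (intro sum.cong refl)
    fix p assume "p \<in> insert v0 Z"
    hence "norm p < 1" using nv0 by (auto simp: Z_def)
    thus "winding_number (circlepath 0 1) p * residue kt p = residue (kern v0) p"
      unfolding kt_def using kern_isolated by (simp add: winding_number_circlepath)
  qed
  also have "\<dots> = residue (kern v0) v0 + (\<Sum>p\<in>Z. residue (kern v0) p)"
    using fZ v0(2) by (intro sum.insert) (auto simp: Z_def)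
  also have "\<dots> = bqH_pole_terms q A a g (jouk g v0) - ratio v0"
    unfolding kern_residue_centre[OF v0] Z_def sum_residues[OF v0] by simp
  finally show ?thesis .
qed

definition \<Psi> :: "real \<Rightarrow> complex" where "\<Psi> \<theta> = kt (cis \<theta>) * \<i> * cis \<theta>"

lemma continuous_\<Psi>: "continuous_on X \<Psi>"
proof -
  have "kt analytic_on sphere 0 1" using kt_analytic_circle by (subst analytic_on_analytic_at) auto
  hence "continuous_on (sphere 0 1) kt"
    by (intro holomorphic_on_imp_continuous_on analytic_imp_holomorphic)
  hence "continuous_on X (\<lambda>\<theta>. kt (cis \<theta>))"
    by (rule continuous_on_compose2) (auto intro!: continuous_intros)
  thus ?thesis unfolding \<Psi>_def[abs_def] by (intro continuous_intros)
qed

text \<open>The angles \<theta> and 2 pi - \<theta> lie over the same t. There \<open>jouk\<close>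
  agrees while w - 1/w changes sign, so the sum contains the jump
  \<open>ratio u - ratio (1 / u)\<close>. The square root is the Jacobian of t = cos
  \<theta>.\<close>

lemma kern_circle:
  assumes t: "t \<in> {-1<..<1}" "t \<notin> wexc"
  shows "(\<Psi> (arccos t) + \<Psi> (2 * pi - arccos t)) / of_real (sqrt (1 - t\<^sup>2)) =
           - (2 * pi * \<i>) * (bqH_weight q A a g t / (jouk g v0 - g * of_real t))"
proof -
  define \<theta> where "\<theta> = arccos t"
  define s where "s = sqrt (1 - t\<^sup>2)"
  define u where "u = circ t"
  have t1: "t \<in> {-1..1}" using t by auto
  have "t\<^sup>2 < 1" using t(1) by (auto simp: abs_square_less_1)
  hence s: "s > 0" by (simp add: s_def)
  have cis: "cis \<theta> = u" unfolding \<theta>_def u_def circ_def by (rule cis_arccos[OF t1])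
  have nu: "norm u = 1" and u0: "u \<noteq> 0" using norm_circ[OF t1] by (auto simp: u_def)
  have cu: "1 / u = cnj u" unfolding u_def by (rule inverse_circ[OF t1])
  have cis': "cis (2 * pi - \<theta>) = 1 / u"
  proof -
    have "cis (2 * pi - \<theta>) = cnj (cis \<theta>)" by (simp add: complex_eq_iff)
    thus ?thesis unfolding cis cu .
  qed
  have dif: "u - 1 / u = 2 * \<i> * of_real s"
    unfolding cu by (simp add: u_def circ_def s_def complex_eq_iff)
  have jg: "jouk g (1 / w) = jouk g w" for w by (simp add: jouk_def add.commute)
  have ju: "jouk g u = g * of_real t"
  proof -
    have "u + 1 / u = 2 * of_real t" unfolding cu by (simp add: u_def circ_def complex_eq_iff)
    thus ?thesis by (simp add: jouk_def)
  qed
  have im: "u \<noteq> 1" "u \<noteq> -1" "1 / u \<noteq> 1" "1 / u \<noteq> -1"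
    using s unfolding cu by (auto simp: u_def circ_def s_def complex_eq_iff)
  have nz: "sl u \<noteq> 0" "sl (1 / u) \<noteq> 0"
    using circle_zeros[OF int, of u] circle_zeros[OF int, of "1 / u"] im nu by (auto simp: norm_divide)
  have P: "kt w * \<i> * w = g / 2 * \<i> * (w - 1 / w) * ratio w / (jouk g v0 - jouk g w)"
    if w: "norm w = 1" "sl w \<noteq> 0" for w
  proof -
    have "w * v0 \<noteq> 1" using w v0 by (intro unit_disc_mult_neq_1) auto
    hence w0: "w \<noteq> 0" "v0 \<noteq> 0" "w \<noteq> v0" "w * v0 \<noteq> 1" using w v0 by auto
    have "kt w = kern v0 w" unfolding kt_def
      by (intro remove_sings_at_analytic kern_analytic w w0)
    also have "\<dots> = g / 2 * (1 - 1 / w\<^sup>2) * (ratio w / (jouk g v0 - jouk g w))"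
      unfolding kern_eq[OF w0, symmetric] deriv_jouk[OF w0(1)] ..
    finally have "kt w * \<i> * w = g / 2 * \<i> * (w * (1 - 1 / w\<^sup>2)) * ratio w / (jouk g v0 - jouk g w)"
      by (simp add: mult_ac)
    also have "w * (1 - 1 / w\<^sup>2) = w - 1 / w" using w0 by (simp add: field_simps power2_eq_square)
    finally show ?thesis .
  qed
  define E where "E = jouk g v0 - g * of_real t"
  have "\<Psi> \<theta> + \<Psi> (2 * pi - \<theta>) =
          g / 2 * \<i> * (u - 1 / u) * ratio u / E + g / 2 * \<i> * (1 / u - 1 / (1 / u)) * ratio (1 / u) / E"
    unfolding \<Psi>_def cis cis' E_def using P[OF nu nz(1)] P[of "1 / u"] nu nz(2)
    by (simp add: norm_divide jg ju)
  also have "1 / u - 1 / (1 / u) = - (u - 1 / u)" by simp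
  also have "g / 2 * \<i> * (u - 1 / u) * ratio u / E + g / 2 * \<i> * - (u - 1 / u) * ratio (1 / u) / E
             = g / 2 * \<i> * (u - 1 / u) * (ratio u - ratio (1 / u)) / E"
    by (simp add: algebra_simps diff_divide_distrib add_divide_distrib)
  also have "\<dots> = - (4 * (of_real s)\<^sup>2) * (\<i> * (wnum u / (sl u * sl (1 / u)))) / E"
    unfolding ratio_jump[OF u0 nz] dif using g0 by (simp add: power2_eq_square)
  finally have "(\<Psi> \<theta> + \<Psi> (2 * pi - \<theta>)) / of_real s = - 4 * of_real s * \<i> * (wnum u / (sl u * sl (1 / u))) / E"
    using s by (simp add: power2_eq_square mult_ac)
  moreover have "bqH_weight q A a g t = 2 * of_real s / of_real pi * (wnum u / (sl u * sl (1 / u)))"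
    using weight_eq[OF t] by (simp add: u_def circ_def s_def)
  ultimately show ?thesis unfolding \<theta>_def[symmetric] s_def[symmetric] E_def[symmetric] by (simp add: mult_ac)
qed

lemma weight_integral:
  "((\<lambda>t. bqH_weight q A a g t / (jouk g v0 - g * of_real t)) has_integral
      (ratio v0 - bqH_pole_terms q A a g (jouk g v0))) {-1..1}"
proof -
  define \<Phi> where "\<Phi> \<theta> = integral {0..\<theta>} \<Psi>" for \<theta>
  \<comment> \<open>An explicit antiderivative replaces the substitution t = cos \<theta>, whose
    Jacobian is singular at the endpoints: continuity up to the endpoints suffices, and
    integrability comes with it. \<open>H (-1)\<close> is 0 and \<open>H 1\<close> is the integral
    over the full circle.\<close>
  define H where "H t = \<Phi> (2 * pi - arccos t) - \<Phi> (arccos t)" for t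
  have der\<Phi>: "(\<Phi> has_vector_derivative \<Psi> \<theta>) (at \<theta> within {0..2 * pi})" if "\<theta> \<in> {0..2 * pi}" for \<theta>
    unfolding \<Phi>_def using that by (intro integral_has_vector_derivative continuous_\<Psi>)
  have cont\<Phi>: "continuous_on {0..2 * pi} \<Phi>"
    using der\<Phi> by (rule continuous_on_vector_derivative)
  have "((\<lambda>t. (\<Psi> (arccos t) + \<Psi> (2 * pi - arccos t)) / of_real (sqrt (1 - t\<^sup>2))) has_integral H 1 - H (-1)) {-1..1}"
  proof (rule fundamental_theorem_of_calculus_interior)
    have "arccos t \<le> 2 * pi" if "t \<in> {-1..1}" for t
      using arccos_ubound[of t] that pi_gt_zero by (auto simp del: pi_gt_zero)
    thus "continuous_on {-1..1} H" unfolding H_def[abs_def]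
      by (intro continuous_intros continuous_on_compose2[OF cont\<Phi>] continuous_on_arccos')
         (auto intro!: arccos_lbound)
    fix t :: real assume t: "t \<in> {-1<..<1}"
    define s where "s = sqrt (1 - t\<^sup>2)"
    have th: "0 < arccos t" "arccos t < pi" using arccos_lt_bounded[of t] t by auto
    have dcos: "(arccos has_real_derivative - (1 / s)) (at t)"
      using DERIV_arccos[of t] t by (simp add: s_def inverse_eq_divide)
    have open\<Phi>: "(\<Phi> has_vector_derivative \<Psi> \<theta>) (at \<theta>)" if "0 < \<theta>" "\<theta> < 2 * pi" for \<theta>
      using der\<Phi>[of \<theta>] that by (simp add: at_within_Icc_at)
    have "((\<Phi> \<circ> arccos) has_vector_derivative (- (1 / s)) *\<^sub>R \<Psi> (arccos t)) (at t)"
      by (rule vector_diff_chain_at)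
         (use dcos open\<Phi>[of "arccos t"] th in \<open>auto simp: has_real_derivative_iff_has_vector_derivative\<close>)
    moreover have "((\<Phi> \<circ> (\<lambda>t. 2 * pi - arccos t)) has_vector_derivative (1 / s) *\<^sub>R \<Psi> (2 * pi - arccos t)) (at t)"
    proof (rule vector_diff_chain_at)
      have "((\<lambda>t. 2 * pi - arccos t) has_real_derivative 1 / s) (at t)"
        using DERIV_diff[OF DERIV_const dcos, of "2 * pi"] by simp
      thus "((\<lambda>t. 2 * pi - arccos t) has_vector_derivative 1 / s) (at t)"
        by (simp add: has_real_derivative_iff_has_vector_derivative)
    qed (use open\<Phi>[of "2 * pi - arccos t"] th in auto)
    ultimately have "(H has_vector_derivative
        (1 / s) *\<^sub>R \<Psi> (2 * pi - arccos t) - (- (1 / s)) *\<^sub>R \<Psi> (arccos t)) (at t)"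
      unfolding H_def[abs_def] o_def by (intro has_vector_derivative_diff)
    thus "(H has_vector_derivative (\<Psi> (arccos t) + \<Psi> (2 * pi - arccos t)) / of_real (sqrt (1 - t\<^sup>2))) (at t)"
      by (simp add: s_def scaleR_conv_of_real add_divide_distrib add.commute)
  qed simp
  also have "H 1 - H (-1) = integral {0..2 * pi} \<Psi>"
    by (simp add: H_def \<Phi>_def)
  also have "\<dots> = contour_integral (circlepath 0 1) kt"
    unfolding circlepath_def by (subst contour_integral_part_circlepath_eq) (simp_all add: \<Psi>_def[abs_def])
  finally have "((\<lambda>t. - (2 * pi * \<i>) * (bqH_weight q A a g t / (jouk g v0 - g * of_real t))) has_integral
                  2 * pi * \<i> * (bqH_pole_terms q A a g (jouk g v0) - ratio v0)) {-1..1}"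
    unfolding kt_contour_integral
  \<comment> \<open>The weight may have accidental values at the points of \<open>wexc\<close>, and
    at the endpoints its formula divides by 0; finitely many points do not affect the
    integral.\<close>
  proof (rule has_integral_spike_finite[rotated 2])
    show "finite (insert (-1) (insert 1 wexc))" using finite_wexc by simp
    show "- (2 * pi * \<i>) * (bqH_weight q A a g t / (jouk g v0 - g * of_real t)) =
        (\<Psi> (arccos t) + \<Psi> (2 * pi - arccos t)) / of_real (sqrt (1 - t\<^sup>2))"
      if "t \<in> {-1..1} - insert (-1) (insert 1 wexc)" for t
      using kern_circle[of t] that by auto
  qed
  from has_integral_mult_right[OF this, of "- 1 / (2 * pi * \<i>)"]
  have "((\<lambda>t. - 1 / (2 * pi * \<i>) * (- (2 * pi * \<i>)) * (bqH_weight q A a g t / (jouk g v0 - g * of_real t)))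
          has_integral - 1 / (2 * pi * \<i>) * (2 * pi * \<i>) * (bqH_pole_terms q A a g (jouk g v0) - ratio v0)) {-1..1}"
    by (simp only: mult.assoc)
  moreover have "- 1 / (2 * pi * \<i>) * (- (2 * pi * \<i>)) = 1" "- 1 / (2 * pi * \<i>) * (2 * pi * \<i>) = -1"
    by simp_all
  ultimately show ?thesis by simp
qed

end

lemma weight_kernel_absolutely_integrable:
  assumes int: "bqH_weight q A a g absolutely_integrable_on {-1..1}" and z: "z \<in> cut_domain g"
  shows "(\<lambda>t. bqH_weight q A a g t / (z - g * of_real t)) absolutely_integrable_on {-1..1}"
proof -
  have ne: "z - g * of_real t \<noteq> 0" if "t \<in> {-1..1}" for t
  proof
    assume "z - g * of_real t = 0"
    hence "z / g = of_real t" using g0 by (simp add: field_simps)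
    thus False using z that by (auto simp: cut_domain_def)
  qed
  have cont: "continuous_on {-1..1} (\<lambda>t. 1 / (z - g * of_real t))"
    by (intro continuous_intros) (use ne in auto)
  have "(\<lambda>t. (1 / (z - g * of_real t)) * bqH_weight q A a g t) absolutely_integrable_on {-1..1}"
  proof (rule absolutely_integrable_bounded_measurable_product
      [where h = "(*)" and f = "\<lambda>t. 1 / (z - g * of_real t)", OF _ _ _ _ int])
    show "bilinear ((*) :: complex \<Rightarrow> _)" by (rule bilinear_times)
    show "(\<lambda>t. 1 / (z - g * of_real t)) \<in> borel_measurable (lebesgue_on {-1..1})"
      by (rule continuous_imp_measurable_on_sets_lebesgue[OF cont]) simp
    show "bounded ((\<lambda>t. 1 / (z - g * of_real t)) ` {-1..1})"
      by (intro compact_imp_bounded compact_continuous_image cont) simp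
  qed simp
  thus ?thesis by simp
qed

end

theorem mainTheorem16:
  fixes q A a g :: complex
  assumes "0 < norm q" and "norm q < 1"
    and "A \<noteq> 0" and "a \<noteq> 0"
    and "\<And>n. n \<ge> 1 \<Longrightarrow> rec_b2 q A a n \<noteq> 0"
    and "g\<^sup>2 = 4 * (a * q / A)"
  shows "(\<forall>z \<in> cut_domain g.
            if is_pole (bqH_ratio q A a g) z
            then cf_converges_to_infinity (bqH_cf_c q A a) (bqH_cf_d q z)
            else cf_converges_to (bqH_cf_c q A a) (bqH_cf_d q z)
                   (remove_sings (bqH_ratio q A a g) z))
       \<and> (\<forall>z \<in> cut_domain g.
            (\<forall>k. Lambda_minus g z / a \<noteq> 1 / q ^ k) \<longrightarrow>
            phi21 q (A / q) (A * Lambda_minus g z) (Lambda_minus g z / a) \<noteq> 0 \<longrightarrow>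
            cf_converges_to (bqH_cf_c q A a) (bqH_cf_d q z) (bqH_ratio q A a g z))
       \<and> finite (bqH_poles q A a g)
       \<and> (bqH_weight q A a g absolutely_integrable_on {-1..1} \<longrightarrow>
            (\<forall>z \<in> cut_domain g - bqH_poles q A a g.
               (\<lambda>t. bqH_weight q A a g t / (z - g * of_real t)) absolutely_integrable_on {-1..1} \<and>
               remove_sings (bqH_ratio q A a g) z =
                 integral {-1..1} (\<lambda>t. bqH_weight q A a g t / (z - g * of_real t))
                 + bqH_pole_terms q A a g z))"
proof -
  interpret bqH_param q A a g
  proof
    show "A * q ^ n \<noteq> 1" for n
      using assms(5)[of "Suc n"] by (auto simp: rec_b2_def)
  qed (use assms in auto)
  have pole: "is_pole (bqH_ratio q A a g) z \<longleftrightarrow> sl (jouk_inv g z) = 0" if "z \<in> cut_domain g" for z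
    by (rule is_pole_bqH_ratio_iff[OF that])
  show ?thesis
  proof (intro conjI ballI impI)
    fix z assume z: "z \<in> cut_domain g"
    show "if is_pole (bqH_ratio q A a g) z
          then cf_converges_to_infinity (bqH_cf_c q A a) (bqH_cf_d q z)
          else cf_converges_to (bqH_cf_c q A a) (bqH_cf_d q z) (remove_sings (bqH_ratio q A a g) z)"
      using cf_convergence[OF z] remove_sings_bqH_ratio[OF z] pole[OF z] by simp
  next
    fix z assume z: "z \<in> cut_domain g" and k: "\<forall>k. Lambda_minus g z / a \<noteq> 1 / q ^ k"
      and nz: "phi21 q (A / q) (A * Lambda_minus g z) (Lambda_minus g z / a) \<noteq> 0"
    have k': "Lambda_minus g z / a * q ^ k \<noteq> 1" for k
      using k q0 by (auto simp: nonzero_eq_divide_eq)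
    have L: "g / 2 * jouk_inv g z = Lambda_minus g z" using g0 by (simp add: jouk_inv_def)
    have "qpoch_inf q (Lambda_minus g z / a) \<noteq> 0"
      using k' qpoch_inf_eq_0_iff[OF q1, of "Lambda_minus g z / a"] by blast
    hence "sl (jouk_inv g z) \<noteq> 0"
      using sol_eq_phi21[OF k', of 0] nz unfolding sl_def L by simp
    from cf_convergence(1)[OF z this] bqH_ratio_eq[OF k']
    show "cf_converges_to (bqH_cf_c q A a) (bqH_cf_d q z) (bqH_ratio q A a g z)" by simp
  next
    show "finite (bqH_poles q A a g)" by (rule finite_bqH_poles)
  next
    fix z assume int: "bqH_weight q A a g absolutely_integrable_on {-1..1}"
      and z: "z \<in> cut_domain g - bqH_poles q A a g"
    show "(\<lambda>t. bqH_weight q A a g t / (z - g * of_real t)) absolutely_integrable_on {-1..1}"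
      using z by (intro weight_kernel_absolutely_integrable int) auto
    have zc: "z \<in> cut_domain g" and nz: "sl (jouk_inv g z) \<noteq> 0"
      using z pole by (auto simp: bqH_poles_def)
    note v = jouk_inv_mem[OF g0 zc]
    from weight_integral[OF int v(1) nz] show "remove_sings (bqH_ratio q A a g) z =
        integral {-1..1} (\<lambda>t. bqH_weight q A a g t / (z - g * of_real t)) + bqH_pole_terms q A a g z"
      unfolding v(2) remove_sings_bqH_ratio[OF zc nz] by (simp add: integral_unique)
  qed
qed

end
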